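(* Let $\mathrm D=D(\mathbb R^l,\mathbb R^d)$, let $X$ be a $\mathrm D$-valued random process, not identical to $0$, defined on a complete probability space, let $\alpha>0$, and let $\nu\in\mathcal M^+(\mathcal B_0)$ be such that its extension to $\mathrm D$ is a tail measure with index $\alpha$. Let $t_0\in\mathbb R^l$ be such that $p_{t_0}=\nu(\{f:\|f(t_0)\|>1\})>0$, and let $a_n>0$, $n\in\mathbb N$, be such that $n\,\mathbb P\{\|X(t_0)\|>a_n\}=p_{t_0}$ for all large $n\in\mathbb N$. Then $X\in\mathscr R_\alpha(\mathcal B_0,\nu)$ is equivalent to $X\in\widetilde{\mathcal R}_\alpha(a_n,\mathcal B_0,\nu)$.
   Context: Space. $\mathrm D=D(\mathbb R^l,\mathbb R^d)$ is the space of generalised càdlàg functions $f:\mathbb R^l\to\mathbb R^d$ (at each point all limits from the $2^l$ quadrants exist, and $f$ is continuous from the upper-right closed quadrant; for $l=1$: right-continuous with left limits), with the Skorohod $J_1$ topology: $f_n\to f$ iff there are time changes $\tau_n:\mathbb R^l\to\mathbb R^l$, acting componentwise by strictly increasing continuous bijections $\tau_{ni}$ of $\mathbb R$ with finite slope norm $\sup_{s\ne t}|\ln((\tau_{ni}(t)-\tau_{ni}(s))/(t-s))|$, with $\sup_s|\tau_{ni}(s)-s|\to0$ for $i\le l$ and $\sup_{t\in[-N,N]}\|f_n(\tau_n(t))-f(t)\|\to0$ for all $N\in\mathbb N^l$; it is Polish with a suitable metric $d_{\mathrm D}$. $\|\cdot\|$ is a norm on $\mathbb R^d$ and $\mathcal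 Q$ a countable dense subset of $\mathbb R^l$. Boundedness. $\mathcal B_0$ consists of the subsets $A$ of $\mathrm D_0=\mathrm D\setminus\{0\}$ bounded away from the zero function in $d_{\mathrm D}$; equivalently, there are a hypercube $K_A$ and $\varepsilon_A>0$ with $\sup_{t\in K_A}\|f(t)\|>\varepsilon_A$ for all $f\in A$. $\mathcal M^+(\mathcal B_0)$ is the set of non-trivial (some Borel set has measure in $(0,\infty)$) Borel measures on $\mathrm D_0$ finite on Borel sets in $\mathcal B_0$; these are extended to $\mathrm D$ by giving $\{0\}$ mass $0$. $\mathcal B_0$-vague convergence means convergence of integrals of bounded continuous functions $\mathrm D_0\to\mathbb R$ with support in $\mathcal B_0$. Tail measure. A Borel measure $\nu$ on $\mathrm D$ is a tail measure with index $\alpha>0$ if $\nu(zA)=z^{-\alpha}\nu(A)$ for $z>0$ and Borel $A$, $\nu(\{0\})=0$, and $\nu(\{f:\|f(h)\|>1\})<\infty$ for all $h\in\mathcal Q$, with a positive value for some $h_0\in\mathcal Q$. Regular variation. $X\in\mathscr R_\alpha(\mathcal B_0,\nu)$ means: $\lim_{z\to\infty}\mathbb P\{\|X(t_0)\|>zt\}/\mathbb P\{\|X(t_0)\|>z\}=t^{-\alpha}$ for all $t>0$, and $p_{t_0}\mathbb P\{z^{-1}X\in\cdot\}/\mathbb P\{\|X(t_0)\|>z\}$ converges $\mathcal B_0$-vaguely to $\nu$ as $z\to\infty$. $X\in\widetilde{\mathcal R}_\alpha(a_n,\mathcal B_0,\nu)$ means: $(a_n)$ is a non-decreasing sequence of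 positive constants with $\lim_{n\to\infty}a_{[nt]}/a_n=t^{1/\alpha}$ for all $t>0$ ($[\cdot]$ denotes integer part), and $n\,\mathbb P\{X\in a_n\,\cdot\,\}$, i.e. $A\mapsto n\mathbb P\{a_n^{-1}X\in A\}$, converges $\mathcal B_0$-vaguely to $\nu$ as $n\to\infty$.
   Formalization: In the sequential notion of regular variation, a_n is required to be non-decreasing only from some index on, since the condition on a_n for large n leaves the first terms arbitrary and the literal equivalence then fails. *)

theory Defs
  imports "HOL-Probability.Probability"
begin

definition is_norm :: "('a::real_vector \<Rightarrow> real) \<Rightarrow> bool" where
  "is_norm N \<longleftrightarrow>
     (\<forall>x. N x = 0 \<longleftrightarrow> x = 0) \<and> (\<forall>c x. N (c *\<^sub>R x) = \<bar>c\<bar> * N x) \<and> (\<forall>x y. N (x + y) \<le> N x + N y)"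

subsection \<open>The space of generalised cadlag functions\<close>

(* The 2^l quadrants at t are indexed by the set S of coordinates in which s lies weakly above t;
   S = UNIV is the closed upper-right quadrant. *)
definition quadrant :: "real^'l \<Rightarrow> 'l set \<Rightarrow> (real^'l) set" where
  "quadrant t S = {s. \<forall>i. if i \<in> S then t $ i \<le> s $ i else s $ i < t $ i}"

definition D_space :: "(real^'l::finite \<Rightarrow> real^'d::finite) set" where
  "D_space = {f. \<forall>t. (\<forall>S. \<exists>L. (f \<longlongrightarrow> L) (at t within quadrant t S)) \<and>
                     continuous (at t within quadrant t UNIV) f}"

definition time_change1 :: "(real \<Rightarrow> real) \<Rightarrow> bool" where
  "time_change1 \<tau> \<longleftrightarrow> strict_mono \<tau> \<and> continuous_on UNIV \<tau> \<and> bij \<tau> \<and>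
     bdd_above {\<bar>ln ((\<tau> t - \<tau> s) / (t - s))\<bar> |s t. s \<noteq> t}"

definition time_change :: "('l \<Rightarrow> real \<Rightarrow> real) \<Rightarrow> real^'l \<Rightarrow> real^'l::finite" where
  "time_change \<tau> t = (\<chi> i. \<tau> i (t $ i))"

(* Uniform convergence is taken in the standard norm of real^'d; since all norms on a
   finite-dimensional space are equivalent, any other norm gives the same notion. *)
definition J1_converges ::
  "(nat \<Rightarrow> real^'l::finite \<Rightarrow> real^'d::finite) \<Rightarrow> (real^'l \<Rightarrow> real^'d) \<Rightarrow> bool" where
  "J1_converges F f \<longleftrightarrow> (\<exists>\<tau> :: nat \<Rightarrow> 'l \<Rightarrow> real \<Rightarrow> real.
     (\<forall>n i. time_change1 (\<tau> n i)) \<and>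
     (\<forall>i. uniform_limit UNIV (\<lambda>n. \<tau> n i) (\<lambda>s. s) sequentially) \<and>
     (\<forall>K :: 'l \<Rightarrow> nat.
        uniform_limit (cbox (\<chi> i. - real (K i)) (\<chi> i. real (K i)))
          (\<lambda>n t. F n (time_change (\<tau> n) t)) f sequentially))"

(* The J1 topology is metrizable, hence determined by its convergent sequences: a set is open iff
   every sequence converging to one of its points is eventually inside it. *)
definition D_open :: "(real^'l::finite \<Rightarrow> real^'d::finite) set \<Rightarrow> bool" where
  "D_open U \<longleftrightarrow> U \<subseteq> D_space \<and>
     (\<forall>f\<in>U. \<forall>F. (\<forall>n. F n \<in> D_space) \<and> J1_converges F f \<longrightarrow> (\<forall>\<^sub>F n in sequentially. F n \<in> U))"

definition D_top :: "(real^'l::finite \<Rightarrow> real^'d::finite) topology" where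
  "D_top = topology D_open"

lemma istopology_D_open: "istopology D_open"
  unfolding istopology_def
proof (intro conjI allI impI)
  fix S T :: "(real^'l::finite \<Rightarrow> real^'d::finite) set"
  assume S: "D_open S" and T: "D_open T"
  show "D_open (S \<inter> T)"
    unfolding D_open_def
  proof (intro conjI ballI allI impI)
    show "S \<inter> T \<subseteq> D_space"
      using S by (auto simp: D_open_def)
  next
    fix f F assume "f \<in> S \<inter> T" "(\<forall>n. F n \<in> D_space) \<and> J1_converges F f"
    then have "\<forall>\<^sub>F n in sequentially. F n \<in> S" "\<forall>\<^sub>F n in sequentially. F n \<in> T"
      using S T unfolding D_open_def by blast+
    then show "\<forall>\<^sub>F n in sequentially. F n \<in> S \<inter> T"
      by eventually_elim simp
  qed
next
  fix \<U> :: "(real^'l::finite \<Rightarrow> real^'d::finite) set set"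
  assume *: "\<forall>U\<in>\<U>. D_open U"
  show "D_open (\<Union>\<U>)"
    unfolding D_open_def
  proof (intro conjI ballI allI impI)
    show "\<Union>\<U> \<subseteq> D_space"
      using * by (auto simp: D_open_def)
  next
    fix f F assume "f \<in> \<Union>\<U>" and F: "(\<forall>n. F n \<in> D_space) \<and> J1_converges F f"
    then obtain U where U: "U \<in> \<U>" "f \<in> U"
      by blast
    then have "\<forall>\<^sub>F n in sequentially. F n \<in> U"
      using * F unfolding D_open_def by blast
    then show "\<forall>\<^sub>F n in sequentially. F n \<in> \<Union>\<U>"
      by eventually_elim (use U in blast)
  qed
qed

lemma openin_D_top: "openin D_top = D_open"
  by (simp add: D_top_def istopology_D_open topology_inverse')

lemma topspace_D_top: "topspace D_top = D_space"
proof -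
  have "D_open D_space"
    by (simp add: D_open_def)
  moreover have "U \<subseteq> D_space" if "D_open U" for U :: "(real^'l::finite \<Rightarrow> real^'d::finite) set"
    using that by (simp add: D_open_def)
  ultimately show ?thesis
    unfolding topspace_def openin_D_top by blast
qed

definition borel_sigma :: "'a topology \<Rightarrow> 'a measure" where
  "borel_sigma T = sigma (topspace T) {U. openin T U}"

abbreviation D_borel :: "(real^'l::finite \<Rightarrow> real^'d::finite) measure" where
  "D_borel \<equiv> borel_sigma D_top"

definition D0_space :: "(real^'l::finite \<Rightarrow> real^'d::finite) set" where
  "D0_space = D_space - {\<lambda>_. 0}"

definition D0_top :: "(real^'l::finite \<Rightarrow> real^'d::finite) topology" where
  "D0_top = subtopology D_top D0_space"

abbreviation D0_borel :: "(real^'l::finite \<Rightarrow> real^'d::finite) measure" where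
  "D0_borel \<equiv> borel_sigma D0_top"

subsection \<open>Boundedness, vague convergence and tail measures\<close>

(* The hypercube is the cube with centre c and half side length r; the supremum is taken in the
   extended reals so that it needs no boundedness argument. *)
definition B0 :: "(real^'d \<Rightarrow> real) \<Rightarrow> (real^'l::finite \<Rightarrow> real^'d::finite) set set" where
  "B0 N = {A. A \<subseteq> D0_space \<and> (\<exists>c r \<epsilon>. 0 < r \<and> 0 < \<epsilon> \<and>
     (\<forall>f\<in>A. (SUP t \<in> cbox (\<chi> i. c $ i - r) (\<chi> i. c $ i + r). ereal (N (f t))) > ereal \<epsilon>))}"

definition M_plus ::
  "(real^'d \<Rightarrow> real) \<Rightarrow> (real^'l::finite \<Rightarrow> real^'d::finite) measure set" where
  "M_plus N = {\<mu>. sets \<mu> = sets D0_borel \<and>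
     (\<exists>A\<in>sets \<mu>. 0 < emeasure \<mu> A \<and> emeasure \<mu> A < \<infinity>) \<and>
     (\<forall>A\<in>sets \<mu> \<inter> B0 N. emeasure \<mu> A < \<infinity>)}"

(* Push-forward along the inclusion of D0 in D, so that the zero function gets mass 0. *)
definition extend_D ::
  "(real^'l::finite \<Rightarrow> real^'d::finite) measure \<Rightarrow> (real^'l \<Rightarrow> real^'d) measure" where
  "extend_D \<mu> = distr \<mu> D_borel (\<lambda>f. f)"

definition vague_limit ::
  "(real^'d \<Rightarrow> real) \<Rightarrow> ('i \<Rightarrow> (real^'l::finite \<Rightarrow> real^'d::finite) measure) \<Rightarrow>
     (real^'l \<Rightarrow> real^'d) measure \<Rightarrow> 'i filter \<Rightarrow> bool" where
  "vague_limit N \<mu> \<nu> F \<longleftrightarrow> (\<forall>h :: (real^'l \<Rightarrow> real^'d) \<Rightarrow> real.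
     continuous_map D0_top euclideanreal h \<and> bounded (h ` D0_space) \<and>
     D0_top closure_of {f \<in> D0_space. h f \<noteq> 0} \<in> B0 N \<longrightarrow>
     ((\<lambda>i. \<integral>f. h f \<partial>\<mu> i) \<longlongrightarrow> (\<integral>f. h f \<partial>\<nu>)) F)"

definition tail_measure ::
  "(real^'d \<Rightarrow> real) \<Rightarrow> (real^'l) set \<Rightarrow> real \<Rightarrow>
     (real^'l::finite \<Rightarrow> real^'d::finite) measure \<Rightarrow> bool" where
  "tail_measure N Q \<alpha> \<nu> \<longleftrightarrow> 0 < \<alpha> \<and> sets \<nu> = sets D_borel \<and>
     (\<forall>z>0. \<forall>A\<in>sets D_borel.
        emeasure \<nu> ((\<lambda>f t. z *\<^sub>R f t) ` A) = ennreal (z powr (- \<alpha>)) * emeasure \<nu> A) \<and>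
     emeasure \<nu> {\<lambda>_. 0} = 0 \<and>
     (\<forall>h\<in>Q. emeasure \<nu> {f \<in> D_space. N (f h) > 1} < \<infinity>) \<and>
     (\<exists>h0\<in>Q. emeasure \<nu> {f \<in> D_space. N (f h0) > 1} > 0)"

subsection \<open>Regular variation\<close>

definition tail_prob ::
  "(real^'d \<Rightarrow> real) \<Rightarrow> 'w measure \<Rightarrow> ('w \<Rightarrow> real^'l::finite \<Rightarrow> real^'d::finite) \<Rightarrow>
     real^'l \<Rightarrow> real \<Rightarrow> real" where
  "tail_prob N M X t0 z = measure M {w \<in> space M. N (X w t0) > z}"

definition tail_const ::
  "(real^'d \<Rightarrow> real) \<Rightarrow> (real^'l::finite \<Rightarrow> real^'d::finite) measure \<Rightarrow> real^'l \<Rightarrow> real" where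
  "tail_const N \<nu> t0 = measure \<nu> {f \<in> D0_space. N (f t0) > 1}"

(* The measure A \<mapsto> c * P(X / z \<in> A) on the Borel sets of D0. *)
definition scaled_law ::
  "'w measure \<Rightarrow> ('w \<Rightarrow> real^'l::finite \<Rightarrow> real^'d::finite) \<Rightarrow> real \<Rightarrow> real \<Rightarrow>
     (real^'l \<Rightarrow> real^'d) measure" where
  "scaled_law M X c z =
     scale_measure (ennreal c) (restrict_space (distr M D_borel (\<lambda>w t. X w t /\<^sub>R z)) D0_space)"

(* If the tail probability in a denominator vanishes for large z, then the first limit is 0 under
   the convention x / 0 = 0, so the condition fails, as it should. *)
definition reg_var ::
  "(real^'d \<Rightarrow> real) \<Rightarrow> real^'l \<Rightarrow> 'w measure \<Rightarrow> ('w \<Rightarrow> real^'l::finite \<Rightarrow> real^'d::finite) \<Rightarrow>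
     real \<Rightarrow> (real^'l \<Rightarrow> real^'d) measure \<Rightarrow> bool" where
  "reg_var N t0 M X \<alpha> \<nu> \<longleftrightarrow>
     (\<forall>t>0. ((\<lambda>z. tail_prob N M X t0 (z * t) / tail_prob N M X t0 z) \<longlongrightarrow> t powr (- \<alpha>)) at_top) \<and>
     vague_limit N (\<lambda>z. scaled_law M X (tail_const N \<nu> t0 / tail_prob N M X t0 z) z) \<nu> at_top"

(* Sequences are indexed from 1. Monotonicity is required from some index on: a normalising
   sequence that is pinned down only for large n (by n * P(|X(t0)| > a n) = p) can be arbitrary
   at its first terms, so monotonicity from the start could never be a consequence of regular
   variation. The remaining conditions do not depend on finitely many terms, apart from
   positivity. *)
definition reg_var_seq ::
  "(real^'d \<Rightarrow> real) \<Rightarrow> 'w measure \<Rightarrow> ('w \<Rightarrow> real^'l::finite \<Rightarrow> real^'d::finite) \<Rightarrow>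
     real \<Rightarrow> (nat \<Rightarrow> real) \<Rightarrow> (real^'l \<Rightarrow> real^'d) measure \<Rightarrow> bool" where
  "reg_var_seq N M X \<alpha> a \<nu> \<longleftrightarrow>
     (\<forall>n\<ge>1. 0 < a n) \<and> (\<exists>n0. mono_on {n0..} a) \<and>
     (\<forall>t>0. (\<lambda>n. a (nat \<lfloor>real n * t\<rfloor>) / a n) \<longlonglongrightarrow> t powr (1 / \<alpha>)) \<and>
     vague_limit N (\<lambda>n. scaled_law M X (real n) (a n)) \<nu> sequentially"

end

theory Submission
  imports Defs "HOL-Real_Asymp.Real_Asymp"
begin

text \<open>
Let \<open>G z\<close> be the probability that the norm of \<open>X\<close> at \<open>t0\<close> exceeds \<open>z\<close>, and let \<open>p\<close> be the tail constant,
so that \<open>n * G (a n) = p\<close> for large \<open>n\<close>. Both notions of regular variation consist of a one-dimensional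
condition, on \<open>G\<close> or on \<open>a\<close>, and of a vague limit.

From the continuous notion to the sequential one, the vague limit is obtained by setting \<open>z = a n\<close>,
where the mass \<open>p / G z\<close> equals \<open>n\<close>. The sequence is eventually increasing and unbounded because \<open>G\<close> is
decreasing and positive, and its regular variation is that of the inverse of \<open>G\<close>
(\<open>quantile_regularly_varying\<close>).

Conversely, a large \<open>z\<close> is bracketed by \<open>a n \<le> z < a (n + 1)\<close>. Monotonicity and regular variation force
\<open>a (n + 1) / a n\<close> to tend to \<open>1\<close>, so \<open>a n / z\<close> tends to \<open>1\<close>, and \<open>p / G z\<close>, which lies between \<open>n\<close> and
\<open>n + 1\<close>, is asymptotic to \<open>n\<close>. This gives the one-dimensional condition (\<open>tail_regularly_varying\<close>) and
reduces the vague limit to the claim that neither a factor of the mass nor a factor of the scale that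
tends to \<open>1\<close> changes it (\<open>vague_limit_change_mass\<close>, \<open>vague_limit_rescale\<close>).

The change of scale is the delicate point, because a test function \<open>h\<close> is continuous but not uniformly
continuous. It is handled by the envelope of \<open>h\<close>, the supremum of \<open>h (c f)\<close> over \<open>\<bar>c - 1\<bar> \<le> \<delta>\<close>. Compactness
of the interval of factors makes the envelope a test function again. It dominates \<open>h\<close> at the new scale
by its own value at the old scale, and its integral tends to that of \<open>h\<close> as \<open>\<delta>\<close> tends to \<open>0\<close>
(\<open>dilation_envelope_integral_tendsto\<close>). Applied to \<open>h\<close> and to \<open>- h\<close> this yields both bounds, without a
metric for the topology. All continuity arguments are sequential, which is faithful because the
topology is defined by its convergent sequences.

That \<open>G\<close> is monotone uses that evaluation at \<open>t0\<close> is Borel measurable although it is not continuous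
(\<open>D_borel_exceedance\<close>).
\<close>

section \<open>Generalised cadlag functions\<close>

text \<open>A norm is convex, and convex functions on a Euclidean space are continuous.\<close>

lemma is_norm_continuous:
  assumes "is_norm (N :: real^'d::finite \<Rightarrow> real)"
  shows "continuous_on UNIV N"
proof (rule convex_on_continuous)
  show "convex_on UNIV N"
  proof (rule convex_onI)
    fix t :: real and x y :: "real^'d" assume "0 < t" "t < 1"
    have "N ((1 - t) *\<^sub>R x + t *\<^sub>R y) \<le> N ((1 - t) *\<^sub>R x) + N (t *\<^sub>R y)"
      using assms unfolding is_norm_def by blast
    also have "\<dots> = (1 - t) * N x + t * N y"
      using assms \<open>0 < t\<close> \<open>t < 1\<close> by (simp add: is_norm_def)
    finally show "N ((1 - t) *\<^sub>R x + t *\<^sub>R y) \<le> (1 - t) * N x + t * N y" .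
  qed simp
qed simp

lemma is_norm_scaleR: "is_norm N \<Longrightarrow> N (c *\<^sub>R x) = \<bar>c\<bar> * N x"
  by (simp add: is_norm_def)

lemma D_space_scaleR: "f \<in> D_space \<Longrightarrow> (\<lambda>t. c *\<^sub>R f t) \<in> D_space"
  unfolding D_space_def by (fastforce intro: tendsto_scaleR tendsto_const continuous_intros)

lemma D0_space_scaleR: "f \<in> D0_space \<Longrightarrow> c \<noteq> 0 \<Longrightarrow> (\<lambda>t. c *\<^sub>R f t) \<in> D0_space"
  by (auto simp: D0_space_def D_space_scaleR fun_eq_iff)

lemma D0_space_subset: "D0_space \<subseteq> D_space"
  by (auto simp: D0_space_def)

text \<open>The finitely many quadrants at \<open>t\<close> cover the space, and \<open>f\<close> has a limit in each of them.\<close>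

lemma D_space_locally_bounded:
  assumes "f \<in> D_space"
  shows "\<exists>B. \<forall>\<^sub>F s in nhds t. norm (f s) \<le> B"
proof -
  from assms obtain L where L: "\<And>S. (f \<longlongrightarrow> L S) (at t within quadrant t S)"
    unfolding D_space_def by (simp add: choice_iff) metis
  let ?B = "Max ((\<lambda>S. norm (L S) + 1) ` UNIV)"
  have le: "norm (L S) + 1 \<le> ?B" for S by (intro Max_ge) auto
  have "\<forall>\<^sub>F s in nhds t. s \<noteq> t \<longrightarrow> s \<in> quadrant t S \<longrightarrow> norm (f s) < norm (L S) + 1" for S
    using order_tendstoD(2)[OF tendsto_norm[OF L[of S]], of "norm (L S) + 1"]
    by (simp add: eventually_at_filter)
  then have "\<forall>\<^sub>F s in nhds t. \<forall>S. s \<noteq> t \<longrightarrow> s \<in> quadrant t S \<longrightarrow> norm (f s) < norm (L S) + 1"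
    by (rule eventually_all_finite)
  then have "\<forall>\<^sub>F s in nhds t. norm (f s) \<le> max ?B (norm (f t))"
  proof eventually_elim
    case (elim s)
    have "s \<in> quadrant t {i. t $ i \<le> s $ i}" by (auto simp: quadrant_def)
    with elim have "s \<noteq> t \<Longrightarrow> norm (f s) < norm (L {i. t $ i \<le> s $ i}) + 1" by blast
    with le[of "{i. t $ i \<le> s $ i}"] have "s \<noteq> t \<Longrightarrow> norm (f s) \<le> ?B" by linarith
    then show ?case by (cases "s = t") (simp_all add: max.coboundedI1 del: Max_ge_iff)
  qed
  then show ?thesis by blast
qed

lemma D_space_bounded_on_compact:
  assumes f: "f \<in> D_space" and K: "compact K"
  shows "bounded (f ` K)"
proof -
  have "\<exists>B U. open U \<and> t \<in> U \<and> (\<forall>s\<in>U. norm (f s) \<le> B)" for t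
    using D_space_locally_bounded[OF f, of t] by (auto simp: eventually_nhds)
  then obtain B U where U: "\<And>t. open (U t)" "\<And>t. t \<in> U t" "\<And>t s. s \<in> U t \<Longrightarrow> norm (f s) \<le> B t"
    by metis
  obtain C where C: "finite C" "K \<subseteq> (\<Union>c\<in>C. U c)"
    using compactE_image[OF K, of UNIV U] U by (metis UN_I UNIV_I subsetI)
  have "norm (f s) \<le> (\<Sum>c\<in>C. \<bar>B c\<bar>)" if "s \<in> K" for s
  proof -
    from C that obtain c where c: "c \<in> C" "s \<in> U c" by blast
    then have "norm (f s) \<le> \<bar>B c\<bar>" using U(3) by force
    also have "\<dots> \<le> (\<Sum>c\<in>C. \<bar>B c\<bar>)" using c C by (intro member_le_sum) auto
    finally show ?thesis .
  qed
  then show ?thesis by (auto simp: bounded_iff)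
qed

text \<open>Convergence survives a moving scalar factor. Uniform convergence of a product needs bounded limits,
which is what boundedness on compact sets supplies.\<close>

lemma J1_converges_scaleR:
  assumes J: "J1_converges F f" and f: "f \<in> D_space" and c: "c \<longlonglongrightarrow> c0"
  shows "J1_converges (\<lambda>n t. c n *\<^sub>R F n t) (\<lambda>t. c0 *\<^sub>R f t)"
proof -
  from J obtain \<tau> where \<tau>: "\<forall>n i. time_change1 (\<tau> n i)"
     "\<forall>i. uniform_limit UNIV (\<lambda>n. \<tau> n i) (\<lambda>s. s) sequentially"
     "\<And>K. uniform_limit (cbox (\<chi> i. - real (K i)) (\<chi> i. real (K i)))
          (\<lambda>n t. F n (time_change (\<tau> n) t)) f sequentially"
    unfolding J1_converges_def by blast
  have "uniform_limit (cbox (\<chi> i. - real (K i)) (\<chi> i. real (K i)))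
          (\<lambda>n t. c n *\<^sub>R F n (time_change (\<tau> n) t)) (\<lambda>t. c0 *\<^sub>R f t) sequentially" for K
    using c by (intro bounded_bilinear_bounded_uniform_limit_intros \<tau>
      D_space_bounded_on_compact f compact_cbox)
      (auto simp: uniform_limit_iff tendsto_iff image_constant_conv)
  with \<tau> show ?thesis unfolding J1_converges_def by blast
qed

lemma J1_converges_subseq:
  assumes J: "J1_converges F f" and r: "filterlim r sequentially sequentially"
  shows "J1_converges (\<lambda>n. F (r n)) f"
proof -
  from J obtain \<tau> where \<tau>: "\<forall>n i. time_change1 (\<tau> n i)"
     "\<forall>i. uniform_limit UNIV (\<lambda>n. \<tau> n i) (\<lambda>s. s) sequentially"
     "\<And>K. uniform_limit (cbox (\<chi> i. - real (K i)) (\<chi> i. real (K i)))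
          (\<lambda>n t. F n (time_change (\<tau> n) t)) f sequentially"
    unfolding J1_converges_def by blast
  show ?thesis
    unfolding J1_converges_def
    by (rule exI[of _ "\<lambda>n. \<tau> (r n)"])
      (auto simp: \<tau> intro!: filterlim_compose[OF \<tau>(2)[rule_format] r] filterlim_compose[OF \<tau>(3) r])
qed

lemma time_change1_id: "time_change1 (\<lambda>s. s)"
proof -
  have "{\<bar>ln ((t - s) / (t - s))\<bar> |s t. s \<noteq> t} \<subseteq> {0::real}" by auto
  then have "bdd_above {\<bar>ln ((t - s) / (t - s))\<bar> |s t::real. s \<noteq> t}"
    by (meson bdd_above_mono bdd_above_finite finite.emptyI finite.insertI)
  then show ?thesis by (simp add: time_change1_def strict_mono_def bij_id[unfolded id_def])
qed

lemma J1_converges_const: "J1_converges (\<lambda>_. f) f"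
  unfolding J1_converges_def
  by (rule exI[of _ "\<lambda>_ _ s. s"])
    (auto simp: time_change1_id time_change_def uniform_limit_const)

text \<open>The only consequence of the time changes that is used for open sets: every value of the limit is
the limit of values taken at nearby points.\<close>

lemma J1_converges_pointwise:
  fixes f :: "real^'l::finite \<Rightarrow> real^'d::finite"
  assumes "J1_converges F f"
  obtains \<tau> where "\<And>t. (\<lambda>n. F n (\<tau> n t)) \<longlonglongrightarrow> f t" "\<And>t. (\<lambda>n. \<tau> n t) \<longlonglongrightarrow> t"
proof -
  from assms obtain \<tau> where \<tau>: "\<And>i. uniform_limit UNIV (\<lambda>n. \<tau> n i) (\<lambda>s. s) sequentially"
     "\<And>K. uniform_limit (cbox (\<chi> i. - real (K i)) (\<chi> i. real (K i)))
          (\<lambda>n t. F n (time_change (\<tau> n) t)) f sequentially"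
    unfolding J1_converges_def by blast
  show ?thesis
  proof (rule that[of "\<lambda>n. time_change (\<tau> n)"])
    fix t :: "real^'l"
    have "t \<in> cbox (\<chi> i. - real (nat \<lceil>\<bar>t $ i\<bar>\<rceil>)) (\<chi> i. real (nat \<lceil>\<bar>t $ i\<bar>\<rceil>))"
      unfolding mem_box_cart
    proof safe
      fix i
      show "(\<chi> i. - real (nat \<lceil>\<bar>t $ i\<bar>\<rceil>)) $ i \<le> t $ i"
        "t $ i \<le> (\<chi> i. real (nat \<lceil>\<bar>t $ i\<bar>\<rceil>)) $ i"
        unfolding vec_lambda_beta by linarith+
    qed
    with \<tau>(2) show "(\<lambda>n. F n (time_change (\<tau> n) t)) \<longlonglongrightarrow> f t"
      by (rule tendsto_uniform_limitI)
    show "(\<lambda>n. time_change (\<tau> n) t) \<longlonglongrightarrow> t"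
    proof (rule vec_tendstoI)
      fix i
      show "(\<lambda>n. time_change (\<tau> n) t $ i) \<longlonglongrightarrow> t $ i"
        using tendsto_uniform_limitI[OF \<tau>(1)[of i], of "t $ i"] by (simp add: time_change_def)
    qed
  qed
qed

section \<open>Sequential description of the topology\<close>

lemma D_openD:
  assumes "D_open U" "f \<in> U" "\<And>n. F n \<in> D_space" "J1_converges F f"
  shows "\<forall>\<^sub>F n in sequentially. F n \<in> U"
  using assms by (auto simp: D_open_def)

text \<open>By passing to a subsequence, it suffices to exclude sequences that avoid \<open>U\<close> altogether.\<close>

lemma D_openI:
  assumes "U \<subseteq> D_space"
    and ex: "\<And>f F. f \<in> U \<Longrightarrow> (\<And>n. F n \<in> D_space) \<Longrightarrow> J1_converges F f \<Longrightarrow> (\<And>n. F n \<notin> U) \<Longrightarrow> False"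
  shows "D_open U"
  unfolding D_open_def
proof (intro conjI ballI allI impI assms(1))
  fix f F assume f: "f \<in> U" and F: "(\<forall>n. F n \<in> D_space) \<and> J1_converges F f"
  show "\<forall>\<^sub>F n in sequentially. F n \<in> U"
  proof (rule ccontr)
    assume "\<not> ?thesis"
    then obtain r :: "nat \<Rightarrow> nat" where r: "strict_mono r" "\<And>n. F (r n) \<notin> U"
      using not_eventually_sequentiallyD by blast
    show False
      using ex[OF f, of "\<lambda>n. F (r n)"] F r J1_converges_subseq[OF _ filterlim_subseq[OF r(1)]] by blast
  qed
qed

text \<open>Time changes move points, so evaluation at a fixed point is not continuous. Whether a value in \<open>V\<close>
is attained somewhere in \<open>U\<close> is nevertheless an open condition; this makes evaluation measurable.\<close>

lemma D_open_exists_value: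
  assumes "open U" "open V"
  shows "D_open {f \<in> D_space. \<exists>s\<in>U. f s \<in> V}"
proof (rule D_openI)
  fix f F assume f: "f \<in> {f \<in> D_space. \<exists>s\<in>U. f s \<in> V}" and F: "\<And>n. F n \<in> D_space"
    and J: "J1_converges F f" and n: "\<And>n. F n \<notin> {f \<in> D_space. \<exists>s\<in>U. f s \<in> V}"
  from f obtain s where s: "s \<in> U" "f s \<in> V" by blast
  obtain \<tau> where \<tau>: "(\<lambda>n. F n (\<tau> n s)) \<longlonglongrightarrow> f s" "(\<lambda>n. \<tau> n s) \<longlonglongrightarrow> s"
    using J1_converges_pointwise[OF J] by metis
  have "\<forall>\<^sub>F n in sequentially. F n (\<tau> n s) \<in> V \<and> \<tau> n s \<in> U"
    using topological_tendstoD[OF \<tau>(1) assms(2) s(2)] topological_tendstoD[OF \<tau>(2) assms(1) s(1)]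
    by eventually_elim simp
  then obtain n where "F n (\<tau> n s) \<in> V \<and> \<tau> n s \<in> U"
    by (auto dest: eventually_happens)
  with n F show False by blast
qed simp

lemma D_open_D0_space: "D_open (D0_space :: (real^'a::finite \<Rightarrow> real^'b::finite) set)"
proof -
  have "(D0_space :: (real^'a \<Rightarrow> real^'b) set) = {f \<in> D_space. \<exists>s\<in>UNIV. f s \<in> - {0}}"
    by (auto simp: D0_space_def fun_eq_iff)
  moreover have "open (- {0 :: real^'b})" by auto
  ultimately show ?thesis using D_open_exists_value[of "UNIV :: (real^'a) set" "- {0 :: real^'b}"] by simp
qed

lemma topspace_D0_top: "topspace D0_top = D0_space"
  using D0_space_subset by (auto simp: D0_top_def topspace_D_top)

lemma openin_D0_top: "openin D0_top U \<longleftrightarrow> D_open U \<and> U \<subseteq> D0_space"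
proof
  assume "openin D0_top U"
  then obtain T where "D_open T" "U = T \<inter> D0_space"
    by (auto simp: D0_top_def openin_subtopology openin_D_top)
  then show "D_open U \<and> U \<subseteq> D0_space"
    using D_open_D0_space istopology_D_open by (auto simp: istopology_def)
next
  assume "D_open U \<and> U \<subseteq> D0_space"
  then show "openin D0_top U"
    by (auto simp: D0_top_def openin_subtopology openin_D_top intro!: exI[of _ U])
qed

text \<open>The approximating functions may vanish: since \<open>D0_space\<close> is open, only finitely many of them do.\<close>

lemma continuous_map_D0_sequentially:
  assumes h: "continuous_map D0_top euclideanreal h"
    and f: "f \<in> D0_space" and F: "\<And>n. F n \<in> D_space" and J: "J1_converges F f"
  shows "(\<lambda>n. h (F n)) \<longlonglongrightarrow> h f"
proof (rule topological_tendstoI)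
  fix V assume V: "open V" "h f \<in> V"
  have "D_open {g \<in> D0_space. h g \<in> V}"
    using openin_continuous_map_preimage[OF h, of V] V by (simp add: openin_D0_top topspace_D0_top)
  then have "\<forall>\<^sub>F n in sequentially. F n \<in> {g \<in> D0_space. h g \<in> V}"
    by (rule D_openD) (use f F J V in auto)
  then show "\<forall>\<^sub>F n in sequentially. h (F n) \<in> V" by eventually_elim simp
qed

lemma continuous_map_D0I:
  assumes h: "\<And>f F. f \<in> D0_space \<Longrightarrow> (\<And>n. F n \<in> D0_space) \<Longrightarrow> J1_converges F f \<Longrightarrow>
    (\<lambda>n. h (F n)) \<longlonglongrightarrow> h f"
  shows "continuous_map D0_top euclideanreal h"
  unfolding continuous_map_def topspace_D0_top
proof (intro conjI allI impI)
  fix V :: "real set" assume "openin euclideanreal V"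
  then have V: "open V" by simp
  have "D_open {f \<in> D0_space. h f \<in> V}"
    unfolding D_open_def
  proof (intro conjI ballI allI impI)
    fix f F assume f: "f \<in> {f \<in> D0_space. h f \<in> V}" and F: "(\<forall>n. F n \<in> D_space) \<and> J1_converges F f"
    have "\<forall>\<^sub>F n in sequentially. F n \<in> D0_space"
      by (rule D_openD[OF D_open_D0_space]) (use f F in auto)
    then obtain k where k: "\<And>n. n \<ge> k \<Longrightarrow> F n \<in> D0_space" by (auto simp: eventually_sequentially)
    have "J1_converges (\<lambda>n. F (n + k)) f"
      using F filterlim_add_const_nat_at_top by (rule J1_converges_subseq[OF conjunct2])
    then have "(\<lambda>n. h (F (n + k))) \<longlonglongrightarrow> h f"
      using f k by (intro h) auto
    then have "(\<lambda>n. h (F n)) \<longlonglongrightarrow> h f" by (rule LIMSEQ_offset)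
    with V f have "\<forall>\<^sub>F n in sequentially. h (F n) \<in> V" by (auto dest: topological_tendstoD)
    moreover have "\<forall>\<^sub>F n in sequentially. F n \<in> D0_space"
      using k by (auto simp: eventually_sequentially)
    ultimately show "\<forall>\<^sub>F n in sequentially. F n \<in> {f \<in> D0_space. h f \<in> V}"
      by eventually_elim simp
  qed (use D0_space_subset in auto)
  then show "openin D0_top {f \<in> D0_space. h f \<in> V}" by (simp add: openin_D0_top)
qed simp

lemma closedin_D0_sequentially:
  assumes A: "closedin D0_top A" and f: "f \<in> D0_space" and F: "\<And>n. F n \<in> A"
    and J: "J1_converges F f"
  shows "f \<in> A"
proof (rule ccontr)
  assume "f \<notin> A"
  moreover have "A \<subseteq> D_space" using A D0_space_subset by (auto simp: closedin_def topspace_D0_top)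
  moreover have "D_open (D0_space - A)"
    using A by (simp add: closedin_def topspace_D0_top openin_D0_top)
  ultimately have "\<forall>\<^sub>F n in sequentially. F n \<in> D0_space - A"
    using f F J by (intro D_openD[of _ f]) auto
  then show False using F by (auto dest: eventually_happens)
qed

lemma closedin_D0I:
  assumes sub: "A \<subseteq> D0_space"
    and lim: "\<And>f F. f \<in> D0_space \<Longrightarrow> (\<And>n. F n \<in> A) \<Longrightarrow> J1_converges F f \<Longrightarrow> f \<in> A"
  shows "closedin D0_top A"
proof -
  have "D_open (D0_space - A)"
    unfolding D_open_def
  proof (intro conjI ballI allI impI)
    fix f F assume f: "f \<in> D0_space - A" and F: "(\<forall>n. F n \<in> D_space) \<and> J1_converges F f"
    have ev: "\<forall>\<^sub>F n in sequentially. F n \<in> D0_space"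
      by (rule D_openD[OF D_open_D0_space]) (use f F in auto)
    have "\<forall>\<^sub>F n in sequentially. F n \<notin> A"
    proof (rule ccontr)
      assume "\<not> ?thesis"
      then obtain r :: "nat \<Rightarrow> nat" where r: "strict_mono r" "\<And>n. F (r n) \<in> A"
        using not_eventually_sequentiallyD by blast
      moreover have "J1_converges (\<lambda>n. F (r n)) f"
        using F filterlim_subseq[OF r(1)] by (rule J1_converges_subseq[OF conjunct2])
      ultimately have "f \<in> A" using f by (intro lim[of f "\<lambda>n. F (r n)"]) auto
      with f show False by simp
    qed
    with ev show "\<forall>\<^sub>F n in sequentially. F n \<in> D0_space - A" by eventually_elim simp
  qed (use D0_space_subset in auto)
  with sub show ?thesis by (simp add: closedin_def topspace_D0_top openin_D0_top)
qed

section \<open>Borel sets\<close>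

lemma space_borel_sigma: "space (borel_sigma T) = topspace T"
  unfolding borel_sigma_def by (rule space_measure_of) (auto dest: openin_subset)

lemma sets_borel_sigma: "sets (borel_sigma T) = sigma_sets (topspace T) {U. openin T U}"
  unfolding borel_sigma_def by (rule sets_measure_of) (auto dest: openin_subset)

lemma openin_borel_sigma: "openin T U \<Longrightarrow> U \<in> sets (borel_sigma T)"
  by (auto simp: sets_borel_sigma)

lemma closedin_borel_sigma: "closedin T A \<Longrightarrow> A \<in> sets (borel_sigma T)"
proof -
  assume A: "closedin T A"
  then have "topspace T - (topspace T - A) \<in> sets (borel_sigma T)"
    by (metis closedin_def openin_borel_sigma sets.compl_sets space_borel_sigma)
  with A show ?thesis by (simp add: closedin_def double_diff)
qed

lemma continuous_map_borel_sigma_measurable: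
  assumes h: "continuous_map T euclideanreal h"
  shows "h \<in> borel_measurable (borel_sigma T)"
proof (rule borel_measurableI)
  fix S :: "real set" assume "open S"
  then have "openin T {x \<in> topspace T. h x \<in> S}"
    using h by (simp add: continuous_map_def)
  moreover have "h -` S \<inter> space (borel_sigma T) = {x \<in> topspace T. h x \<in> S}"
    by (auto simp: space_borel_sigma)
  ultimately show "h -` S \<inter> space (borel_sigma T) \<in> sets (borel_sigma T)"
    by (simp add: openin_borel_sigma)
qed

text \<open>The scaled laws live on the restricted \<open>\<sigma>\<close>-algebra, the limit measure on the Borel sets of the
subspace topology; test functions have to be measurable for both.\<close>

lemma sets_D0_borel:
  "sets (D0_borel :: (real^'l::finite \<Rightarrow> real^'d::finite) measure) = sets (restrict_space D_borel D0_space)"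
proof -
  let ?D0 = "D0_space :: (real^'l \<Rightarrow> real^'d) set"
  have D0: "?D0 \<in> sigma_sets D_space {U. openin D_top U}"
    using D_open_D0_space by (auto simp: openin_D_top)
  have "sets (restrict_space D_borel ?D0) = (\<inter>) ?D0 ` sigma_sets D_space {U. openin D_top U}"
    by (simp add: sets_restrict_space sets_borel_sigma topspace_D_top)
  also have "\<dots> = sigma_sets ?D0 ((\<inter>) ?D0 ` {U. openin D_top U})"
    by (rule sigma_sets_Int[OF D0 D0_space_subset])
  also have "(\<inter>) ?D0 ` {U. openin D_top U} = {U. openin D0_top U}"
    by (auto simp: D0_top_def openin_subtopology)
  finally show ?thesis by (simp add: sets_borel_sigma topspace_D0_top)
qed

lemma D0_space_sets: "D0_space \<in> sets D_borel"
  by (simp add: openin_borel_sigma openin_D_top D_open_D0_space)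

lemma scaleR_D_borel_measurable: "(\<lambda>f t. c *\<^sub>R f t) \<in> measurable D_borel D_borel"
proof (rule measurable_sigma_sets[OF sets_borel_sigma])
  fix U :: "(real^'a \<Rightarrow> real^'b) set" assume "U \<in> {U. openin D_top U}"
  then have U: "D_open U" by (simp add: openin_D_top)
  have "D_open {f \<in> D_space. (\<lambda>t. c *\<^sub>R f t) \<in> U}"
    unfolding D_open_def
  proof (intro conjI ballI allI impI)
    fix f F assume f: "f \<in> {f \<in> D_space. (\<lambda>t. c *\<^sub>R f t) \<in> U}"
      and F: "(\<forall>n. F n \<in> D_space) \<and> J1_converges F f"
    have "\<forall>\<^sub>F n in sequentially. (\<lambda>t. c *\<^sub>R F n t) \<in> U"
      using f F by (intro D_openD[OF U _ _ J1_converges_scaleR[of F]] D_space_scaleR) auto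
    then show "\<forall>\<^sub>F n in sequentially. F n \<in> {f \<in> D_space. (\<lambda>t. c *\<^sub>R f t) \<in> U}"
      by eventually_elim (use F in simp)
  qed auto
  moreover have "(\<lambda>f t. c *\<^sub>R f t) -` U \<inter> space D_borel = {f \<in> D_space. (\<lambda>t. c *\<^sub>R f t) \<in> U}"
    by (auto simp: space_borel_sigma topspace_D_top)
  ultimately show "(\<lambda>f t. c *\<^sub>R f t) -` U \<inter> space D_borel \<in> sets D_borel"
    by (simp add: openin_borel_sigma openin_D_top)
qed (use openin_subset in \<open>fastforce simp: space_borel_sigma topspace_D_top D_space_scaleR\<close>)+

text \<open>By continuity from the closed upper-right quadrant, \<open>N (f t0) > z\<close> holds iff for some rational
\<open>q > z\<close> all values of \<open>N \<circ> f\<close> on a small open box with lower corner \<open>t0\<close> are at least \<open>q\<close>.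
The complementary condition, a value below \<open>q\<close> somewhere in the box, is open.\<close>

lemma D_borel_exceedance:
  fixes N :: "real^'d::finite \<Rightarrow> real" and t0 :: "real^'l::finite"
  assumes N: "continuous_on UNIV N"
  shows "{f \<in> D_space. N (f t0) > z} \<in> sets D_borel"
proof -
  define U :: "nat \<Rightarrow> (real^'l) set" where
    "U k = box t0 (\<chi> i. t0 $ i + 1 / real (Suc k))" for k
  define E where "E q k = {f \<in> D_space. \<exists>s\<in>U k. N (f s) < q}" for q k
  have eq: "{f \<in> D_space. N (f t0) > z} = (\<Union>q\<in>{q\<in>\<rat>. q > z}. \<Union>k. D_space - E q k)"
  proof (intro equalityI subsetI)
    fix f assume "f \<in> {f \<in> D_space. N (f t0) > z}"
    then have f: "f \<in> D_space" "z < N (f t0)" by auto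
    obtain q where q: "q \<in> \<rat>" "z < q" "q < N (f t0)" using Rats_dense_in_real f(2) by blast
    have "(f \<longlongrightarrow> f t0) (at t0 within quadrant t0 UNIV)"
      using f by (auto simp: D_space_def continuous_within)
    then have "((\<lambda>s. N (f s)) \<longlongrightarrow> N (f t0)) (at t0 within quadrant t0 UNIV)"
      using N continuous_on_tendsto_compose by fastforce
    from order_tendstoD(1)[OF this q(3)] obtain d where
      d: "d > 0" "\<And>s. s \<in> quadrant t0 UNIV \<Longrightarrow> s \<noteq> t0 \<Longrightarrow> dist s t0 < d \<Longrightarrow> q < N (f s)"
      by (auto simp: eventually_at)
    obtain k where k: "real CARD('l) / d < real (Suc k)"
      using reals_Archimedean2 less_trans of_nat_less_iff lessI by metis
    \<comment> \<open>The box with side \<open>1 / (k + 1)\<close> has \<open>l1\<close>-diameter \<open>CARD('l) / (k + 1) < d\<close>.\<close>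
    have "q < N (f s)" if s: "s \<in> U k" for s
    proof (rule d(2))
      have *: "t0 $ i < s $ i" "s $ i < t0 $ i + 1 / real (Suc k)" for i
        using s by (auto simp: U_def mem_box_cart)
      show "s \<in> quadrant t0 UNIV" using * by (auto simp: quadrant_def less_imp_le)
      show "s \<noteq> t0" using * by auto
      have "dist s t0 \<le> (\<Sum>i\<in>UNIV. \<bar>(s - t0) $ i\<bar>)" unfolding dist_norm by (rule norm_le_l1_cart)
      also have "\<dots> \<le> (\<Sum>i\<in>(UNIV :: 'l set). 1 / real (Suc k))"
      proof (rule sum_mono)
        fix i
        show "\<bar>(s - t0) $ i\<bar> \<le> 1 / real (Suc k)" using *[of i] by (simp add: abs_if)
      qed
      also have "\<dots> = real CARD('l) / real (Suc k)" by simp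
      also have "\<dots> < d" using k d(1) by (simp add: field_simps)
      finally show "dist s t0 < d" .
    qed
    then have "f \<in> D_space - E q k" using f by (auto simp: E_def) (meson less_asym)
    then show "f \<in> (\<Union>q\<in>{q\<in>\<rat>. q > z}. \<Union>k. D_space - E q k)" using q by blast
  next
    fix f assume "f \<in> (\<Union>q\<in>{q\<in>\<rat>. q > z}. \<Union>k. D_space - E q k)"
    then obtain q k where q: "z < q" and f: "f \<in> D_space" "\<And>s. s \<in> U k \<Longrightarrow> q \<le> N (f s)"
      by (force simp: E_def)
    \<comment> \<open>Points on the diagonal of the box that tend to its corner.\<close>
    define x :: "nat \<Rightarrow> real^'l" where "x n = (\<chi> i. t0 $ i + 1 / real (Suc (Suc (n + k))))" for n
    have x: "x n \<in> U k" "x n \<in> quadrant t0 UNIV" "x n \<noteq> t0" for n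
      by (auto simp: x_def U_def mem_box_cart quadrant_def vec_eq_iff field_simps)
    have "x \<longlonglongrightarrow> t0"
    proof (rule vec_tendstoI)
      fix i
      have "(\<lambda>n. t0 $ i + 1 / real (Suc (Suc (n + k)))) \<longlonglongrightarrow> t0 $ i"
        by real_asymp
      then show "(\<lambda>n. x n $ i) \<longlonglongrightarrow> t0 $ i" by (simp add: x_def)
    qed
    with x have "filterlim x (at t0 within quadrant t0 UNIV) sequentially"
      by (auto simp: filterlim_at)
    moreover have "(f \<longlongrightarrow> f t0) (at t0 within quadrant t0 UNIV)"
      using f by (auto simp: D_space_def continuous_within)
    ultimately have "(\<lambda>n. f (x n)) \<longlonglongrightarrow> f t0" by (rule filterlim_compose[rotated])
    then have "(\<lambda>n. N (f (x n))) \<longlonglongrightarrow> N (f t0)"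
      using N continuous_on_tendsto_compose by fastforce
    then have "q \<le> N (f t0)" by (rule LIMSEQ_le_const) (use f x in auto)
    with q f show "f \<in> {f \<in> D_space. N (f t0) > z}" by simp
  qed
  have "E q k \<in> sets D_borel" for q k
  proof -
    have "open {x. N x < q}" using N by (intro open_Collect_less continuous_on_const)
    moreover have "open (U k)" unfolding U_def by (rule open_box)
    ultimately have "D_open (E q k)" unfolding E_def
      using D_open_exists_value[of "U k" "{x. N x < q}"] by simp
    then show ?thesis by (simp add: openin_borel_sigma openin_D_top)
  qed
  moreover have "D_space \<in> sets D_borel"
    using sets.top[of D_borel] by (simp add: space_borel_sigma topspace_D_top)
  ultimately show ?thesis unfolding eq
    by (intro sets.countable_UN' sets.countable_UN sets.Diff countable_Collect)
      (auto simp: countable_rat)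
qed

section \<open>Dilation envelopes\<close>

text \<open>The integrands that define \<open>vague_limit\<close>.\<close>

definition test_function ::
  "(real^'d \<Rightarrow> real) \<Rightarrow> ((real^'l::finite \<Rightarrow> real^'d::finite) \<Rightarrow> real) \<Rightarrow> bool" where
  "test_function N h \<longleftrightarrow> continuous_map D0_top euclideanreal h \<and> bounded (h ` D0_space) \<and>
     D0_top closure_of {f \<in> D0_space. h f \<noteq> 0} \<in> B0 N"

lemma vague_limit_iff:
  "vague_limit N \<mu> \<nu> F \<longleftrightarrow>
     (\<forall>h. test_function N h \<longrightarrow> ((\<lambda>i. \<integral>f. h f \<partial>\<mu> i) \<longlongrightarrow> (\<integral>f. h f \<partial>\<nu>)) F)"
  by (simp add: vague_limit_def test_function_def)

text \<open>The least upper bound of \<open>h\<close> along the dilates of \<open>f\<close> by factors near \<open>1\<close>. It absorbs a change of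
the normalisation by such a factor, and it replaces the uniform continuity of \<open>h\<close>, which is not
available for a merely continuous integrand.\<close>

definition dilation_envelope ::
  "real \<Rightarrow> ((real^'l::finite \<Rightarrow> real^'d::finite) \<Rightarrow> real) \<Rightarrow> (real^'l \<Rightarrow> real^'d) \<Rightarrow> real" where
  "dilation_envelope \<delta> h f = (SUP c\<in>{1-\<delta>..1+\<delta>}. h (\<lambda>t. c *\<^sub>R f t))"

lemma B0_mono: "A \<in> B0 N \<Longrightarrow> B \<subseteq> A \<Longrightarrow> B \<in> B0 N"
  unfolding B0_def by blast

text \<open>The functions that some admissible dilation carries into \<open>A\<close>; it contains the support of the
envelope if \<open>A\<close> contains the support of \<open>h\<close>.\<close>

definition dilation_hull ::
  "real \<Rightarrow> (real^'l::finite \<Rightarrow> real^'d::finite) set \<Rightarrow> (real^'l \<Rightarrow> real^'d) set" where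
  "dilation_hull \<delta> A = {f \<in> D0_space. \<exists>c\<in>{1-\<delta>..1+\<delta>}. (\<lambda>t. c *\<^sub>R f t) \<in> A}"

text \<open>Compactness of the interval of factors: along a subsequence the factors converge, and so do the
dilated functions.\<close>

lemma closedin_dilation_hull:
  assumes A: "closedin D0_top A" and \<delta>: "0 \<le> \<delta>" "\<delta> < 1"
  shows "closedin D0_top (dilation_hull \<delta> A)"
proof (rule closedin_D0I)
  fix f F assume f: "f \<in> D0_space" and F: "\<And>n. F n \<in> dilation_hull \<delta> A" and J: "J1_converges F f"
  from F have "\<forall>n. \<exists>c. c \<in> {1-\<delta>..1+\<delta>} \<and> (\<lambda>t. c *\<^sub>R F n t) \<in> A"
    unfolding dilation_hull_def by blast
  then obtain c where c: "\<And>n. c n \<in> {1-\<delta>..1+\<delta>}" "\<And>n. (\<lambda>t. c n *\<^sub>R F n t) \<in> A"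
    using choice[of "\<lambda>n c. c \<in> {1-\<delta>..1+\<delta>} \<and> (\<lambda>t. c *\<^sub>R F n t) \<in> A"] by blast
  obtain l r where l: "l \<in> {1-\<delta>..1+\<delta>}" and r: "strict_mono r" "(c \<circ> r) \<longlonglongrightarrow> l"
    using c(1) seq_compactE[OF compact_imp_seq_compact[OF compact_Icc]] by metis
  have "J1_converges (\<lambda>n t. (c \<circ> r) n *\<^sub>R F (r n) t) (\<lambda>t. l *\<^sub>R f t)"
    using f D0_space_subset
    by (intro J1_converges_scaleR r(2) J1_converges_subseq[OF J] filterlim_subseq[OF r(1)]) auto
  moreover have "(\<lambda>t. l *\<^sub>R f t) \<in> D0_space"
    using l \<delta> by (intro D0_space_scaleR f) auto
  ultimately have "(\<lambda>t. l *\<^sub>R f t) \<in> A"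
    using closedin_D0_sequentially[OF A, of _ "\<lambda>n t. (c \<circ> r) n *\<^sub>R F (r n) t"] c(2) by simp
  with l f show "f \<in> dilation_hull \<delta> A" by (auto simp: dilation_hull_def)
qed (auto simp: dilation_hull_def)

text \<open>A dilation by at most \<open>1 + \<delta> < 2\<close> at worst halves the lower bound on the supremum over the cube.\<close>

lemma B0_dilation_hull:
  assumes N: "is_norm N" and A: "A \<in> B0 N" and \<delta>: "0 \<le> \<delta>" "\<delta> < 1"
  shows "dilation_hull \<delta> A \<in> B0 N"
proof -
  from A obtain c r e where cr: "0 < r" "0 < e"
    "\<And>f. f \<in> A \<Longrightarrow> (SUP t \<in> cbox (\<chi> i. c $ i - r) (\<chi> i. c $ i + r). ereal (N (f t))) > ereal e"
    unfolding B0_def by blast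
  have "(SUP t \<in> cbox (\<chi> i. c $ i - r) (\<chi> i. c $ i + r). ereal (N (f t))) > ereal (e / 2)"
    if f: "f \<in> dilation_hull \<delta> A" for f
  proof -
    from f obtain s where s: "1 - \<delta> \<le> s" "s \<le> 1 + \<delta>" "(\<lambda>t. s *\<^sub>R f t) \<in> A"
      by (auto simp: dilation_hull_def)
    then obtain t where t: "t \<in> cbox (\<chi> i. c $ i - r) (\<chi> i. c $ i + r)" "e < N (s *\<^sub>R f t)"
      using cr(3)[OF s(3)] unfolding less_SUP_iff by auto
    have "e < s * N (f t)" using t(2) s \<delta> by (simp add: is_norm_scaleR[OF N])
    moreover have "N (f t) > 0"
      using calculation cr(2) s \<delta> by (smt (verit) mult_nonneg_nonpos)
    then have "s * N (f t) \<le> 2 * N (f t)" using s \<delta> by (intro mult_right_mono) auto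
    ultimately have "e / 2 < N (f t)" by linarith
    with t(1) show ?thesis unfolding less_SUP_iff by auto
  qed
  moreover have "dilation_hull \<delta> A \<subseteq> D0_space" by (auto simp: dilation_hull_def)
  moreover have "0 < e / 2" using cr(2) by simp
  ultimately show ?thesis using cr(1) unfolding B0_def by blast
qed

lemma test_function_minus: "test_function N h \<Longrightarrow> test_function N (\<lambda>f. - h f)"
  unfolding test_function_def by (auto intro: continuous_map_minus simp: bounded_iff)

context
  fixes N :: "real^'d::finite \<Rightarrow> real" and h :: "(real^'l::finite \<Rightarrow> real^'d) \<Rightarrow> real"
  assumes h: "test_function N h"
begin

lemma test_function_continuous: "continuous_map D0_top euclideanreal h"
  using h by (simp add: test_function_def)

lemma test_function_bounded: obtains C where "C \<ge> 0" "\<And>f. f \<in> D0_space \<Longrightarrow> \<bar>h f\<bar> \<le> C"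
proof -
  from h obtain C where "\<And>f. f \<in> D0_space \<Longrightarrow> \<bar>h f\<bar> \<le> C"
    by (auto simp: test_function_def bounded_iff)
  then show ?thesis by (intro that[of "max C 0"]) (auto intro: max.coboundedI1)
qed

context
  fixes \<delta> :: real
  assumes \<delta>: "0 \<le> \<delta>" "\<delta> < 1"
begin

lemma dilation_D0: "c \<in> {1-\<delta>..1+\<delta>} \<Longrightarrow> f \<in> D0_space \<Longrightarrow> (\<lambda>t. c *\<^sub>R f t) \<in> D0_space"
  using \<delta> by (auto intro: D0_space_scaleR)

lemma dilation_envelope_upper:
  assumes "f \<in> D0_space" "c \<in> {1-\<delta>..1+\<delta>}"
  shows "h (\<lambda>t. c *\<^sub>R f t) \<le> dilation_envelope \<delta> h f"
proof -
  obtain C where C: "\<And>f. f \<in> D0_space \<Longrightarrow> \<bar>h f\<bar> \<le> C" using test_function_bounded by metis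
  have "bdd_above ((\<lambda>c. h (\<lambda>t. c *\<^sub>R f t)) ` {1-\<delta>..1+\<delta>})"
    using C[OF dilation_D0[OF _ assms(1)]] by (intro bdd_aboveI2[of _ _ C]) (auto simp: abs_le_iff)
  then show ?thesis unfolding dilation_envelope_def using assms(2) by (intro cSUP_upper)
qed

lemma dilation_envelope_least:
  assumes "\<And>c. c \<in> {1-\<delta>..1+\<delta>} \<Longrightarrow> h (\<lambda>t. c *\<^sub>R f t) \<le> y"
  shows "dilation_envelope \<delta> h f \<le> y"
  unfolding dilation_envelope_def using \<delta> assms by (intro cSUP_least) auto

text \<open>Dilation is jointly continuous in the factor and the function, and the factors range over a compact
set; hence convergence is uniform in the factor. A violation of uniformity would produce convergent
factors along which the two sides have the same limit.\<close>

lemma uniform_dilations: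
  assumes f: "f \<in> D0_space" and F: "\<And>n. F n \<in> D0_space" and J: "J1_converges F f" and e: "e > 0"
  shows "\<forall>\<^sub>F n in sequentially. \<forall>c\<in>{1-\<delta>..1+\<delta>}.
    \<bar>h (\<lambda>t. c *\<^sub>R F n t) - h (\<lambda>t. c *\<^sub>R f t)\<bar> < e"
proof (rule ccontr)
  assume "\<not> ?thesis"
  then obtain r :: "nat \<Rightarrow> nat" where r: "strict_mono r"
    and ex: "\<forall>n. \<exists>c\<in>{1-\<delta>..1+\<delta>}. \<not> \<bar>h (\<lambda>t. c *\<^sub>R F (r n) t) - h (\<lambda>t. c *\<^sub>R f t)\<bar> < e"
    by (blast dest: not_eventually_sequentiallyD)
  define P where "P n c \<longleftrightarrow> c \<in> {1-\<delta>..1+\<delta>} \<and>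
    \<not> \<bar>h (\<lambda>t. c *\<^sub>R F (r n) t) - h (\<lambda>t. c *\<^sub>R f t)\<bar> < e" for n c
  from ex have "\<forall>n. \<exists>c. P n c" by (simp add: P_def Bex_def)
  from choice[OF this] obtain c where c: "\<And>n. c n \<in> {1-\<delta>..1+\<delta>}"
    "\<And>n. \<not> \<bar>h (\<lambda>t. c n *\<^sub>R F (r n) t) - h (\<lambda>t. c n *\<^sub>R f t)\<bar> < e"
    unfolding P_def by blast
  obtain l s where l: "l \<in> {1-\<delta>..1+\<delta>}" and s: "strict_mono s" "(c \<circ> s) \<longlonglongrightarrow> l"
    using c(1) seq_compactE[OF compact_imp_seq_compact[OF compact_Icc]] by metis
  have rs: "filterlim (\<lambda>n. r (s n)) sequentially sequentially"
    using filterlim_subseq[OF strict_mono_o[OF r s(1)]] by (simp add: o_def)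
  have D: "f \<in> D_space" "F n \<in> D_space" for n
    using f F D0_space_subset by auto
  note lim = continuous_map_D0_sequentially[OF test_function_continuous dilation_D0[OF l f]]
  have "(\<lambda>n. h (\<lambda>t. (c \<circ> s) n *\<^sub>R F (r (s n)) t)) \<longlonglongrightarrow> h (\<lambda>t. l *\<^sub>R f t)"
    by (rule lim) (intro D_space_scaleR D J1_converges_scaleR s(2) J1_converges_subseq[OF J rs])+
  moreover have "(\<lambda>n. h (\<lambda>t. (c \<circ> s) n *\<^sub>R f t)) \<longlonglongrightarrow> h (\<lambda>t. l *\<^sub>R f t)"
    by (rule lim) (intro D_space_scaleR D J1_converges_scaleR s(2) J1_converges_const)+
  ultimately have "(\<lambda>n. h (\<lambda>t. (c \<circ> s) n *\<^sub>R F (r (s n)) t) - h (\<lambda>t. (c \<circ> s) n *\<^sub>R f t))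
      \<longlonglongrightarrow> h (\<lambda>t. l *\<^sub>R f t) - h (\<lambda>t. l *\<^sub>R f t)"
    by (rule tendsto_diff)
  from tendsto_rabs[OF this]
  have "\<forall>\<^sub>F n in sequentially.
      \<bar>h (\<lambda>t. (c \<circ> s) n *\<^sub>R F (r (s n)) t) - h (\<lambda>t. (c \<circ> s) n *\<^sub>R f t)\<bar> < e"
    by (rule order_tendstoD(2)) (use e in simp)
  with c(2) show False by (auto dest: eventually_happens)
qed

lemma dilation_envelope_continuous: "continuous_map D0_top euclideanreal (dilation_envelope \<delta> h)"
proof (rule continuous_map_D0I)
  fix f and F :: "nat \<Rightarrow> real^'l \<Rightarrow> real^'d"
  assume f: "f \<in> D0_space" and F: "\<And>n. F n \<in> D0_space" and J: "J1_converges F f"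
  show "(\<lambda>n. dilation_envelope \<delta> h (F n)) \<longlonglongrightarrow> dilation_envelope \<delta> h f"
  proof (rule tendstoI)
    fix e :: real assume "e > 0"
    from uniform_dilations[OF f F J, of "e/2"] \<open>e > 0\<close>
    have "\<forall>\<^sub>F n in sequentially. \<forall>c\<in>{1-\<delta>..1+\<delta>}.
      \<bar>h (\<lambda>t. c *\<^sub>R F n t) - h (\<lambda>t. c *\<^sub>R f t)\<bar> < e / 2" by simp
    then show "\<forall>\<^sub>F n in sequentially. dist (dilation_envelope \<delta> h (F n)) (dilation_envelope \<delta> h f) < e"
    proof eventually_elim
      case (elim n)
      have "dilation_envelope \<delta> h (F n) \<le> dilation_envelope \<delta> h f + e / 2"
      proof (rule dilation_envelope_least)
        fix c assume c: "c \<in> {1-\<delta>..1+\<delta>}"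
        with elim have "\<bar>h (\<lambda>t. c *\<^sub>R F n t) - h (\<lambda>t. c *\<^sub>R f t)\<bar> < e / 2" by blast
        with dilation_envelope_upper[OF f c]
        show "h (\<lambda>t. c *\<^sub>R F n t) \<le> dilation_envelope \<delta> h f + e / 2" by linarith
      qed
      moreover have "dilation_envelope \<delta> h f \<le> dilation_envelope \<delta> h (F n) + e / 2"
      proof (rule dilation_envelope_least)
        fix c assume c: "c \<in> {1-\<delta>..1+\<delta>}"
        with elim have "\<bar>h (\<lambda>t. c *\<^sub>R F n t) - h (\<lambda>t. c *\<^sub>R f t)\<bar> < e / 2" by blast
        with dilation_envelope_upper[OF F[of n] c]
        show "h (\<lambda>t. c *\<^sub>R f t) \<le> dilation_envelope \<delta> h (F n) + e / 2" by linarith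
      qed
      ultimately show ?case using \<open>e > 0\<close> by (auto simp: dist_real_def abs_if)
    qed
  qed
qed

lemma dilation_envelope_support:
  assumes "f \<in> D0_space" "dilation_envelope \<delta> h f \<noteq> 0"
  shows "f \<in> dilation_hull \<delta> (D0_top closure_of {f \<in> D0_space. h f \<noteq> 0})"
proof (rule ccontr)
  assume n: "\<not> ?thesis"
  have "h (\<lambda>t. c *\<^sub>R f t) = 0" if c: "c \<in> {1-\<delta>..1+\<delta>}" for c
  proof (rule ccontr)
    assume "h (\<lambda>t. c *\<^sub>R f t) \<noteq> 0"
    then have "(\<lambda>t. c *\<^sub>R f t) \<in> {f \<in> D0_space. h f \<noteq> 0}" using dilation_D0[OF c assms(1)] by simp
    also have "\<dots> \<subseteq> D0_top closure_of {f \<in> D0_space. h f \<noteq> 0}"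
      by (rule closure_of_subset) (auto simp: topspace_D0_top)
    finally show False using n c assms(1) by (auto simp: dilation_hull_def)
  qed
  then have "dilation_envelope \<delta> h f = 0"
    unfolding dilation_envelope_def using \<delta> by simp
  with assms show False by simp
qed

lemma test_function_dilation_envelope:
  assumes N: "is_norm N"
  shows "test_function N (dilation_envelope \<delta> h)"
  unfolding test_function_def
proof (intro conjI dilation_envelope_continuous)
  obtain C where C: "\<And>f. f \<in> D0_space \<Longrightarrow> \<bar>h f\<bar> \<le> C" using test_function_bounded by metis
  have "\<bar>dilation_envelope \<delta> h f\<bar> \<le> C" if f: "f \<in> D0_space" for f
  proof (rule abs_leI)
    show "dilation_envelope \<delta> h f \<le> C"
      using C dilation_D0[OF _ f] by (intro dilation_envelope_least) (fastforce simp: abs_le_iff)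
    have "- C \<le> h (\<lambda>t. 1 *\<^sub>R f t)" using C[OF f] by (simp add: abs_le_iff)
    also have "\<dots> \<le> dilation_envelope \<delta> h f" using \<delta> by (intro dilation_envelope_upper f) simp
    finally show "- dilation_envelope \<delta> h f \<le> C" by simp
  qed
  then show "bounded (dilation_envelope \<delta> h ` D0_space)" by (auto simp: bounded_iff)
  let ?A = "dilation_hull \<delta> (D0_top closure_of {f \<in> D0_space. h f \<noteq> 0})"
  have "?A \<in> B0 N" using h by (intro B0_dilation_hull N \<delta>) (simp add: test_function_def)
  moreover have "D0_top closure_of {f \<in> D0_space. dilation_envelope \<delta> h f \<noteq> 0} \<subseteq> ?A"
    using dilation_envelope_support
    by (intro closure_of_minimal closedin_dilation_hull closedin_closure_of \<delta>) auto
  ultimately show "D0_top closure_of {f \<in> D0_space. dilation_envelope \<delta> h f \<noteq> 0} \<in> B0 N"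
    by (rule B0_mono)
qed

end

text \<open>The envelopes with \<open>\<delta> = 1/2, 1/3, \<dots>\<close> converge to \<open>h\<close> because \<open>h\<close> is continuous along the ray
through \<open>f\<close>.\<close>

lemma dilation_envelope_tendsto:
  assumes f: "f \<in> D0_space"
  shows "(\<lambda>k. dilation_envelope (1 / real (k + 2)) h f) \<longlonglongrightarrow> h f"
proof (rule LIMSEQ_I)
  fix e :: real assume e: "e > 0"
  have "isCont (\<lambda>c. h (\<lambda>t. c *\<^sub>R f t)) 1"
    unfolding continuous_at_sequentially o_def
  proof safe
    fix c :: "nat \<Rightarrow> real" assume c: "c \<longlonglongrightarrow> 1"
    have "(\<lambda>t. 1 *\<^sub>R f t) \<in> D0_space" "f \<in> D_space" using f D0_space_subset by auto
    then show "(\<lambda>n. h (\<lambda>t. c n *\<^sub>R f t)) \<longlonglongrightarrow> h (\<lambda>t. 1 *\<^sub>R f t)"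
      by (intro continuous_map_D0_sequentially[OF test_function_continuous]
        J1_converges_scaleR J1_converges_const c D_space_scaleR)
  qed
  then obtain d where d: "d > 0"
    and "\<forall>c. dist c 1 < d \<longrightarrow> dist (h (\<lambda>t. c *\<^sub>R f t)) (h (\<lambda>t. 1 *\<^sub>R f t)) < e / 2"
    using half_gt_zero[OF e] unfolding continuous_at_eps_delta by blast
  then have hd: "\<bar>h (\<lambda>t. c *\<^sub>R f t) - h f\<bar> < e / 2" if "\<bar>c - 1\<bar> < d" for c
    using that by (simp add: dist_real_def)
  obtain k0 where k0: "1 / d < real k0" using reals_Archimedean2 by blast
  have "norm (dilation_envelope (1 / real (k + 2)) h f - h f) < e" if k: "k \<ge> k0" for k
  proof -
    have "1 / d < real (k + 2)" using k k0 by linarith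
    then have k2: "1 / real (k + 2) < d" using d by (simp add: field_simps)
    have \<delta>: "0 \<le> 1 / real (k + 2)" "1 / real (k + 2) < 1" by auto
    have "dilation_envelope (1 / real (k + 2)) h f \<le> h f + e / 2"
    proof (rule dilation_envelope_least[OF \<delta>])
      fix c assume "c \<in> {1 - 1 / real (k + 2)..1 + 1 / real (k + 2)}"
      then have "\<bar>c - 1\<bar> < d" using k2 unfolding atLeastAtMost_iff by linarith
      then show "h (\<lambda>t. c *\<^sub>R f t) \<le> h f + e / 2" using hd[of c] by linarith
    qed
    moreover have "h (\<lambda>t. 1 *\<^sub>R f t) \<le> dilation_envelope (1 / real (k + 2)) h f"
      by (rule dilation_envelope_upper[OF \<delta> f]) simp
    ultimately show ?thesis using e by (simp add: abs_if)
  qed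
  then show "\<exists>k0. \<forall>k\<ge>k0. norm (dilation_envelope (1 / real (k + 2)) h f - h f) < e" by blast
qed

lemma test_function_measurable:
  "sets \<mu> = sets D0_borel \<Longrightarrow> h \<in> borel_measurable \<mu>"
  using continuous_map_borel_sigma_measurable[OF test_function_continuous] measurable_cong_sets by blast

end

text \<open>Dominated convergence: all the envelopes are bounded by the same constant and supported in one hull,
which is a set of finite measure because it is in \<open>B0\<close>.\<close>

lemma dilation_envelope_integral_tendsto:
  fixes \<nu> :: "(real^'l::finite \<Rightarrow> real^'d::finite) measure"
  assumes N: "is_norm N" and \<nu>: "\<nu> \<in> M_plus N" and h: "test_function N h"
  shows "(\<lambda>k. \<integral>f. dilation_envelope (1 / real (k + 2)) h f \<partial>\<nu>) \<longlonglongrightarrow> (\<integral>f. h f \<partial>\<nu>)"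
proof -
  let ?A = "dilation_hull (1/2) (D0_top closure_of {f \<in> D0_space. h f \<noteq> 0})"
  from \<nu> have sets: "sets \<nu> = sets D0_borel"
    and fin: "\<And>A. A \<in> sets \<nu> \<Longrightarrow> A \<in> B0 N \<Longrightarrow> emeasure \<nu> A < \<infinity>"
    by (auto simp: M_plus_def)
  have space: "space \<nu> = D0_space"
    using sets_eq_imp_space_eq[OF sets] by (simp add: space_borel_sigma topspace_D0_top)
  have A: "?A \<in> sets \<nu>" unfolding sets
    by (intro closedin_borel_sigma closedin_dilation_hull closedin_closure_of) auto
  moreover have "?A \<in> B0 N"
    using h by (intro B0_dilation_hull N) (auto simp: test_function_def)
  ultimately have fA: "emeasure \<nu> ?A < \<infinity>" by (rule fin)
  obtain C where C: "C \<ge> 0" "\<And>f. f \<in> D0_space \<Longrightarrow> \<bar>h f\<bar> \<le> C"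
    using test_function_bounded[OF h] by metis
  have \<delta>: "0 \<le> 1 / real (k + 2)" "1 / real (k + 2) < 1" "1 / real (k + 2) \<le> 1 / 2" for k
    by (auto simp: field_simps)
  show ?thesis
  proof (rule integral_dominated_convergence[where w = "\<lambda>f. C * indicator ?A f"])
    show "h \<in> borel_measurable \<nu>"
      by (rule test_function_measurable[OF h sets])
    show "dilation_envelope (1 / real (k + 2)) h \<in> borel_measurable \<nu>" for k
      by (rule test_function_measurable[OF test_function_dilation_envelope[OF h \<delta>(1,2) N] sets])
    show "integrable \<nu> (\<lambda>f. C * indicator ?A f)"
      using A fA by (intro integrable_mult_right integrable_real_indicator)
    show "AE f in \<nu>. (\<lambda>k. dilation_envelope (1 / real (k + 2)) h f) \<longlonglongrightarrow> h f"
      using dilation_envelope_tendsto[OF h] by (intro AE_I2) (simp add: space)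
    show "AE f in \<nu>. norm (dilation_envelope (1 / real (k + 2)) h f) \<le> C * indicator ?A f" for k
    proof (rule AE_I2)
      fix f assume "f \<in> space \<nu>"
      then have f: "f \<in> D0_space" by (simp add: space)
      show "norm (dilation_envelope (1 / real (k + 2)) h f) \<le> C * indicator ?A f"
      proof (cases "dilation_envelope (1 / real (k + 2)) h f = 0")
        case False
        then have "f \<in> dilation_hull (1 / real (k + 2)) (D0_top closure_of {f \<in> D0_space. h f \<noteq> 0})"
          by (rule dilation_envelope_support[OF h \<delta>(1,2) f])
        then have "f \<in> ?A"
          using \<delta>(3)[of k] unfolding dilation_hull_def
          by (auto simp only: mem_Collect_eq atLeastAtMost_iff intro!: bexI conjI)
        moreover have "dilation_envelope (1 / real (k + 2)) h f \<le> C"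
          using C(2)[OF dilation_D0[OF h \<delta>(1,2) _ f]]
          by (intro dilation_envelope_least[OF h \<delta>(1,2)]) (fastforce simp: abs_le_iff)
        moreover have "h (\<lambda>t. 1 *\<^sub>R f t) \<le> dilation_envelope (1 / real (k + 2)) h f"
          by (rule dilation_envelope_upper[OF h \<delta>(1,2) f]) simp
        ultimately show ?thesis using C(2)[OF f] by (auto simp: abs_le_iff)
      qed (use C in simp)
    qed
  qed
qed

section \<open>Changing the normalisation in a vague limit\<close>

lemma integral_scale_measure:
  fixes f :: "'a \<Rightarrow> real"
  assumes "f \<in> borel_measurable M" "0 \<le> c"
  shows "integral\<^sup>L (scale_measure (ennreal c) M) f = c * integral\<^sup>L M f"
proof -
  have "scale_measure (ennreal c) M = density M (\<lambda>_. ennreal c)"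
    by (rule measure_eqI) (simp_all add: emeasure_density_const)
  then show ?thesis using assms by (simp add: integral_density)
qed

context
  fixes M :: "'w measure" and X :: "'w \<Rightarrow> real^'l::finite \<Rightarrow> real^'d::finite"
  assumes M: "prob_space M" and X: "X \<in> measurable M D_borel"
begin

text \<open>The expectation of \<open>h (X / z)\<close> on the event \<open>X \<noteq> 0\<close>: the integral of \<open>h\<close> against the scaled law of
mass one, written on the probability space so that different normalisations can be compared
pointwise.\<close>

definition D0_expectation :: "((real^'l \<Rightarrow> real^'d) \<Rightarrow> real) \<Rightarrow> real \<Rightarrow> real" where
  "D0_expectation h z =
     (\<integral>w. indicator D0_space (\<lambda>t. X w t /\<^sub>R z) * h (\<lambda>t. X w t /\<^sub>R z) \<partial>M)"

lemma scaled_process_measurable: "(\<lambda>w t. X w t /\<^sub>R z) \<in> measurable M D_borel"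
  by (rule measurable_compose[OF X scaleR_D_borel_measurable])

lemma D0_part_measurable:
  assumes "test_function N h"
  shows "(\<lambda>f. indicator D0_space f * h f) \<in> borel_measurable D_borel"
proof -
  have "h \<in> borel_measurable (restrict_space D_borel D0_space)"
    by (rule test_function_measurable[OF assms]) (simp add: sets_D0_borel)
  moreover have "D0_space \<inter> space D_borel \<in> sets D_borel"
    by (simp add: D0_space_sets sets.Int_space_eq2)
  ultimately show ?thesis by (subst (asm) borel_measurable_restrict_space_iff) auto
qed

lemma integral_scaled_law:
  assumes h: "test_function N h" and c: "0 \<le> c"
  shows "(\<integral>f. h f \<partial>scaled_law M X c z) = c * D0_expectation h z"
proof -
  have D0: "D0_space \<inter> space (distr M D_borel (\<lambda>w t. X w t /\<^sub>R z)) \<in>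
      sets (distr M D_borel (\<lambda>w t. X w t /\<^sub>R z))"
    unfolding sets_distr space_distr by (intro sets.Int D0_space_sets sets.top)
  have "sets (restrict_space (distr M D_borel (\<lambda>w t. X w t /\<^sub>R z)) D0_space) = sets D0_borel"
    unfolding sets_D0_borel by (rule sets_restrict_space_cong) simp
  then have "(\<integral>f. h f \<partial>scaled_law M X c z) =
      c * (\<integral>f. h f \<partial>restrict_space (distr M D_borel (\<lambda>w t. X w t /\<^sub>R z)) D0_space)"
    unfolding scaled_law_def by (intro integral_scale_measure test_function_measurable[OF h] c)
  also have "(\<integral>f. h f \<partial>restrict_space (distr M D_borel (\<lambda>w t. X w t /\<^sub>R z)) D0_space) =
      (\<integral>f. indicator D0_space f * h f \<partial>distr M D_borel (\<lambda>w t. X w t /\<^sub>R z))"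
    using integral_restrict_space[OF D0, of h] by (simp only: real_scaleR_def)
  also have "\<dots> = D0_expectation h z"
    unfolding D0_expectation_def
    by (rule integral_distr[OF scaled_process_measurable D0_part_measurable[OF h]])
  finally show ?thesis .
qed

lemma D0_expectation_integrable:
  assumes h: "test_function N h"
  shows "integrable M (\<lambda>w. indicator D0_space (\<lambda>t. X w t /\<^sub>R z) * h (\<lambda>t. X w t /\<^sub>R z))"
proof -
  interpret prob_space M by (rule M)
  obtain C where C: "C \<ge> 0" "\<And>f. f \<in> D0_space \<Longrightarrow> \<bar>h f\<bar> \<le> C"
    using test_function_bounded[OF h] by metis
  show ?thesis
    by (rule integrable_const_bound[where B = C])
      (use C measurable_compose[OF scaled_process_measurable D0_part_measurable[OF h]]
        in \<open>auto simp: indicator_def\<close>)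
qed

lemma D0_expectation_minus: "D0_expectation (\<lambda>f. - h f) z = - D0_expectation h z"
  by (simp add: D0_expectation_def)

text \<open>\<open>X / z\<close> is the dilate of \<open>X / b\<close> by the factor \<open>b / z\<close>.\<close>

lemma D0_expectation_le_envelope:
  assumes N: "is_norm N" and h: "test_function N h" and \<delta>: "0 \<le> \<delta>" "\<delta> < 1"
    and z: "0 < b" "0 < z" "b / z \<in> {1-\<delta>..1+\<delta>}"
  shows "D0_expectation h z \<le> D0_expectation (dilation_envelope \<delta> h) b"
  unfolding D0_expectation_def
proof (rule integral_mono)
  fix w assume "w \<in> space M"
  then have "X w \<in> D_space"
    using measurable_space[OF X] by (simp add: space_borel_sigma topspace_D_top)
  then have D: "(\<lambda>t. X w t /\<^sub>R y) \<in> D0_space \<longleftrightarrow> X w \<noteq> (\<lambda>_. 0)" if "y > 0" for y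
    using that by (auto simp: D0_space_def D_space_scaleR fun_eq_iff)
  have eq: "(\<lambda>t. X w t /\<^sub>R z) = (\<lambda>t. (b / z) *\<^sub>R (X w t /\<^sub>R b))"
    using z by (simp add: field_simps)
  show "indicator D0_space (\<lambda>t. X w t /\<^sub>R z) * h (\<lambda>t. X w t /\<^sub>R z)
      \<le> indicator D0_space (\<lambda>t. X w t /\<^sub>R b) * dilation_envelope \<delta> h (\<lambda>t. X w t /\<^sub>R b)"
  proof (cases "X w = (\<lambda>_. 0)")
    case False
    then have "h (\<lambda>t. X w t /\<^sub>R z) \<le> dilation_envelope \<delta> h (\<lambda>t. X w t /\<^sub>R b)"
      unfolding eq using D[OF z(1)] by (intro dilation_envelope_upper[OF h \<delta>] z(3)) simp
    then show ?thesis using False D z by simp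
  next
    case True
    then show ?thesis using D[OF z(1)] D[OF z(2)] by (simp add: indicator_def)
  qed
qed (intro D0_expectation_integrable[OF h]
    D0_expectation_integrable[OF test_function_dilation_envelope[OF h \<delta> N]])+

lemma vague_limit_scaled_law_iff:
  assumes "\<forall>\<^sub>F i in F. 0 \<le> c i"
  shows "vague_limit N (\<lambda>i. scaled_law M X (c i) (b i)) \<nu> F \<longleftrightarrow>
    (\<forall>h. test_function N h \<longrightarrow> ((\<lambda>i. c i * D0_expectation h (b i)) \<longlongrightarrow> (\<integral>f. h f \<partial>\<nu>)) F)"
proof -
  have "((\<lambda>i. \<integral>f. h f \<partial>scaled_law M X (c i) (b i)) \<longlongrightarrow> l) F \<longleftrightarrow>
      ((\<lambda>i. c i * D0_expectation h (b i)) \<longlongrightarrow> l) F" if "test_function N h" for h l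
    by (intro tendsto_cong eventually_mono[OF assms] integral_scaled_law[OF that])
  then show ?thesis by (simp add: vague_limit_iff)
qed

text \<open>An upper bound for the new integrals comes from an envelope whose integral is close to that of \<open>h\<close>; the lower bound
is the upper bound for \<open>- h\<close>.\<close>

lemma vague_limit_rescale:
  assumes N: "is_norm N" and \<nu>: "\<nu> \<in> M_plus N"
    and lim: "vague_limit N (\<lambda>i. scaled_law M X (c i) (b i)) \<nu> F"
    and c: "\<forall>\<^sub>F i in F. 0 \<le> c i" and b: "\<forall>\<^sub>F i in F. 0 < b i" and z: "\<forall>\<^sub>F i in F. 0 < z i"
    and ratio: "((\<lambda>i. b i / z i) \<longlongrightarrow> 1) F"
  shows "vague_limit N (\<lambda>i. scaled_law M X (c i) (z i)) \<nu> F"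
  unfolding vague_limit_scaled_law_iff[OF c]
proof (intro allI impI)
  have upper: "\<forall>\<^sub>F i in F. c i * D0_expectation h (z i) < y"
    if h: "test_function N h" and y: "(\<integral>f. h f \<partial>\<nu>) < y" for h y
  proof -
    have "\<forall>\<^sub>F k in sequentially. (\<integral>f. dilation_envelope (1 / real (k + 2)) h f \<partial>\<nu>) < y"
      by (rule order_tendstoD(2)[OF dilation_envelope_integral_tendsto[OF N \<nu> h] y])
    then obtain k where k: "(\<integral>f. dilation_envelope (1 / real (k + 2)) h f \<partial>\<nu>) < y"
      by (auto dest: eventually_happens)
    define \<delta> where "\<delta> = 1 / real (k + 2)"
    have \<delta>: "0 \<le> \<delta>" "\<delta> < 1" "\<delta> > 0" by (auto simp: \<delta>_def)
    have "((\<lambda>i. c i * D0_expectation (dilation_envelope \<delta> h) (b i)) \<longlongrightarrow>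
        (\<integral>f. dilation_envelope \<delta> h f \<partial>\<nu>)) F"
      using lim test_function_dilation_envelope[OF h \<delta>(1,2) N]
      unfolding vague_limit_scaled_law_iff[OF c] by blast
    from order_tendstoD(2)[OF this, of y]
    have "\<forall>\<^sub>F i in F. c i * D0_expectation (dilation_envelope \<delta> h) (b i) < y"
      using k by (simp add: \<delta>_def)
    moreover have "\<forall>\<^sub>F i in F. 1 - \<delta> < b i / z i" "\<forall>\<^sub>F i in F. b i / z i < 1 + \<delta>"
      using order_tendstoD[OF ratio] \<delta>(3) by auto
    ultimately show ?thesis using b c z
    proof eventually_elim
      case (elim i)
      have "D0_expectation h (z i) \<le> D0_expectation (dilation_envelope \<delta> h) (b i)"
        using elim by (intro D0_expectation_le_envelope[OF N h \<delta>(1,2)]) auto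
      then have "c i * D0_expectation h (z i) \<le> c i * D0_expectation (dilation_envelope \<delta> h) (b i)"
        using elim by (intro mult_left_mono)
      then show ?case using elim by linarith
    qed
  qed
  fix h :: "(real^'l \<Rightarrow> real^'d) \<Rightarrow> real" assume h: "test_function N h"
  show "((\<lambda>i. c i * D0_expectation h (z i)) \<longlongrightarrow> (\<integral>f. h f \<partial>\<nu>)) F"
  proof (rule order_tendstoI)
    fix y assume "y < (\<integral>f. h f \<partial>\<nu>)"
    then show "\<forall>\<^sub>F i in F. y < c i * D0_expectation h (z i)"
      using upper[OF test_function_minus[OF h], of "- y"] by (simp add: D0_expectation_minus)
  qed (rule upper[OF h])
qed

lemma vague_limit_change_mass:
  assumes lim: "vague_limit N (\<lambda>i. scaled_law M X (c i) (b i)) \<nu> F"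
    and c: "\<forall>\<^sub>F i in F. 0 < c i" and c': "\<forall>\<^sub>F i in F. 0 \<le> c' i"
    and ratio: "((\<lambda>i. c' i / c i) \<longlongrightarrow> 1) F"
  shows "vague_limit N (\<lambda>i. scaled_law M X (c' i) (b i)) \<nu> F"
  unfolding vague_limit_scaled_law_iff[OF c']
proof (intro allI impI)
  fix h :: "(real^'l \<Rightarrow> real^'d) \<Rightarrow> real" assume h: "test_function N h"
  have "\<forall>\<^sub>F i in F. 0 \<le> c i" using c by eventually_elim simp
  from vague_limit_scaled_law_iff[OF this] lim h
  have "((\<lambda>i. c i * D0_expectation h (b i)) \<longlongrightarrow> (\<integral>f. h f \<partial>\<nu>)) F" by blast
  from tendsto_mult[OF ratio this]
  have "((\<lambda>i. c' i / c i * (c i * D0_expectation h (b i))) \<longlongrightarrow> (\<integral>f. h f \<partial>\<nu>)) F" by simp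
  then show "((\<lambda>i. c' i * D0_expectation h (b i)) \<longlongrightarrow> (\<integral>f. h f \<partial>\<nu>)) F"
    by (rule Lim_transform_eventually) (use c in \<open>eventually_elim, simp\<close>)
qed

end

lemma vague_limit_compose:
  assumes "vague_limit N \<mu> \<nu> G" and "filterlim g G F"
  shows "vague_limit N (\<lambda>i. \<mu> (g i)) \<nu> F"
  using assms(1) unfolding vague_limit_iff
  by (auto intro!: filterlim_compose[OF _ assms(2), of "\<lambda>i. integral\<^sup>L (\<mu> i) _"])

lemma vague_limit_cong:
  assumes "\<forall>\<^sub>F i in F. \<mu> i = \<mu>' i"
  shows "vague_limit N \<mu> \<nu> F \<longleftrightarrow> vague_limit N \<mu>' \<nu> F"
proof -
  have "((\<lambda>i. integral\<^sup>L (\<mu> i) h) \<longlongrightarrow> l) F \<longleftrightarrow> ((\<lambda>i. integral\<^sup>L (\<mu>' i) h) \<longlongrightarrow> l) F"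
    for h :: "_ \<Rightarrow> real" and l
    by (rule tendsto_cong) (use assms in eventually_elim, simp)
  then show ?thesis by (simp add: vague_limit_iff)
qed

section \<open>Regularly varying tails and their quantiles\<close>

lemma floor_mult_at_top:
  fixes t :: real assumes "t > 0"
  shows "filterlim (\<lambda>n. nat \<lfloor>real n * t\<rfloor>) at_top sequentially"
  using assms by real_asymp

text \<open>The functions \<open>c \<mapsto> c powr (-\<alpha>)\<close> and \<open>t \<mapsto> t powr (1/\<alpha>)\<close> are inverse to each other up to a reciprocal; in
this form the index \<open>-\<alpha>\<close> of the tail and the index \<open>1/\<alpha>\<close> of the quantiles are translated into each
other.\<close>

lemma powr_threshold:
  fixes c t \<alpha> :: real
  assumes "\<alpha> > 0" "c > 0" "t > 0"
  shows "c powr (-\<alpha>) < inverse t \<longleftrightarrow> t powr (1/\<alpha>) < c"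
    and "inverse t < c powr (-\<alpha>) \<longleftrightarrow> c < t powr (1/\<alpha>)"
proof -
  have eq: "(t powr (1/\<alpha>)) powr (-\<alpha>) = inverse t"
    using assms by (simp add: powr_powr powr_minus)
  have less_iff: "x powr (-\<alpha>) < y powr (-\<alpha>) \<longleftrightarrow> y < x" if "x > 0" "y > 0" for x y
    using powr_less_mono2_neg[of "-\<alpha>" x y] powr_less_mono2_neg[of "-\<alpha>" y x] that assms(1)
    by (cases x y rule: linorder_cases) auto
  show "c powr (-\<alpha>) < inverse t \<longleftrightarrow> t powr (1/\<alpha>) < c"
    unfolding eq[symmetric] using assms by (intro less_iff) auto
  show "inverse t < c powr (-\<alpha>) \<longleftrightarrow> c < t powr (1/\<alpha>)"
    unfolding eq[symmetric] using assms by (intro less_iff) auto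
qed

lemma eventually_less_of_limits:
  fixes u v :: "'a \<Rightarrow> real"
  assumes "(u \<longlongrightarrow> x) F" "(v \<longlongrightarrow> y) F" "x < y"
  shows "\<forall>\<^sub>F n in F. u n < v n"
proof -
  have "((\<lambda>n. v n - u n) \<longlongrightarrow> y - x) F"
    using assms by (intro tendsto_diff)
  from order_tendstoD(1)[OF this, of 0] show ?thesis
    using assms(3) by (simp add: less_diff_eq)
qed

text \<open>The one-dimensional side of the theorem: \<open>G\<close> stands for the tail of the distribution of the norm at
\<open>t0\<close>, and \<open>a n\<close> is, for large \<open>n\<close>, an exact quantile of level \<open>p / n\<close>. Exactness matters: it turns every
comparison of values of \<open>a\<close> into one of values of \<open>G\<close>.\<close>

locale tail_quantile =
  fixes G :: "real \<Rightarrow> real" and a :: "nat \<Rightarrow> real" and p \<alpha> :: real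
  assumes G_antimono: "antimono G" and G_nonneg: "\<And>z. 0 \<le> G z"
    and p_pos: "0 < p" and \<alpha>_pos: "0 < \<alpha>"
    and a_pos: "\<And>n. n \<ge> 1 \<Longrightarrow> 0 < a n"
    and quantile: "\<forall>\<^sub>F n in sequentially. real n * G (a n) = p"
begin

lemma G_le: "x \<le> y \<Longrightarrow> G y \<le> G x"
  using G_antimono by (rule antimonoD)

lemma less_if_G_less: "G x < G y \<Longrightarrow> y < x"
  using G_le[of x y] by (metis leD not_le_imp_less)

lemma G_quantile: "\<forall>\<^sub>F n in sequentially. G (a n) = p / real n"
  using quantile eventually_gt_at_top[of 0] by eventually_elim (simp add: field_simps)

lemma a_pos_eventually: "\<forall>\<^sub>F n in sequentially. 0 < a n"
  using eventually_ge_at_top[of 1] by eventually_elim (rule a_pos)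

lemma G_pos: "filterlim a at_top sequentially \<Longrightarrow> 0 < G z"
proof -
  assume "filterlim a at_top sequentially"
  then have "\<forall>\<^sub>F n in sequentially. z \<le> a n"
    by (simp add: filterlim_at_top)
  with G_quantile eventually_gt_at_top[of 0] have "\<forall>\<^sub>F n in sequentially. 0 < G z"
  proof eventually_elim
    case (elim n)
    have "0 < p / real n" using p_pos elim by simp
    also have "\<dots> = G (a n)" using elim by simp
    also have "\<dots> \<le> G z" using elim by (intro G_le)
    finally show ?case .
  qed
  then show ?thesis by (auto dest: eventually_happens)
qed

lemma quantile_at_top:
  assumes G: "\<And>z. 0 < G z"
  shows "filterlim a at_top sequentially"
  unfolding filterlim_at_top
proof
  fix Z
  have "(\<lambda>n. p / real n) \<longlonglongrightarrow> 0" by real_asymp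
  from order_tendstoD(2)[OF this G[of Z]] G_quantile
  show "\<forall>\<^sub>F n in sequentially. Z \<le> a n"
  proof eventually_elim
    case (elim n)
    then have "G (a n) < G Z" by simp
    then show ?case by (rule less_imp_le[OF less_if_G_less])
  qed
qed

lemma quantile_eventually_mono: "\<exists>n0. mono_on {n0..} a"
proof -
  from G_quantile obtain n1 where n1: "\<And>n. n \<ge> n1 \<Longrightarrow> G (a n) = p / real n"
    by (auto simp: eventually_sequentially)
  have "mono_on {Suc n1..} a"
  proof (intro mono_onI)
    fix m n :: nat assume mn: "m \<in> {Suc n1..}" "n \<in> {Suc n1..}" "m \<le> n"
    show "a m \<le> a n"
    proof (cases "m = n")
      case False
      then have "p / real n < p / real m"
        using mn p_pos by (intro divide_strict_left_mono) auto
      then have "G (a n) < G (a m)"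
        using n1[of m] n1[of n] mn by simp
      then show ?thesis by (rule less_imp_le[OF less_if_G_less])
    qed simp
  qed
  then show ?thesis by blast
qed

text \<open>Inversion of regular variation: with \<open>k = \<lfloor>n t\<rfloor>\<close>, the inequality \<open>a k < y * a n\<close> follows from
\<open>G (a n * y) < G (a k)\<close>. After division by \<open>G (a n) = p / n\<close> the two sides tend to \<open>y powr (-\<alpha>)\<close> and
\<open>1 / t\<close>.\<close>

lemma quantile_regularly_varying:
  assumes rv: "\<And>t. t > 0 \<Longrightarrow> ((\<lambda>z. G (z * t) / G z) \<longlongrightarrow> t powr (-\<alpha>)) at_top"
    and top: "filterlim a at_top sequentially" and t: "t > 0"
  shows "(\<lambda>n. a (nat \<lfloor>real n * t\<rfloor>) / a n) \<longlonglongrightarrow> t powr (1 / \<alpha>)"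
proof -
  let ?k = "\<lambda>n. nat \<lfloor>real n * t\<rfloor>"
  have k: "(\<lambda>n. real n / real (?k n)) \<longlonglongrightarrow> inverse t"
    using t by real_asymp
  have c: "(\<lambda>n. G (a n * c) / G (a n)) \<longlonglongrightarrow> c powr (-\<alpha>)" if "c > 0" for c
    using rv[OF that] top by (rule filterlim_compose)
  have kpos: "\<forall>\<^sub>F n in sequentially. ?k n > 0"
    using eventually_compose_filterlim[OF eventually_gt_at_top[of 0] floor_mult_at_top[OF t]] .
  have Gk: "\<forall>\<^sub>F n in sequentially. G (a (?k n)) = p / real (?k n)"
    using eventually_compose_filterlim[OF G_quantile floor_mult_at_top[OF t]] .
  have ak: "\<forall>\<^sub>F n in sequentially. a (?k n) > 0"
    using eventually_compose_filterlim[OF a_pos_eventually floor_mult_at_top[OF t]] .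
  note ev = Gk kpos ak G_quantile a_pos_eventually eventually_gt_at_top[of 0]
  show ?thesis
  proof (rule order_tendstoI)
    fix y assume y: "t powr (1 / \<alpha>) < y"
    have "y > 0" using t by (intro less_trans[OF _ y]) simp
    with y have "y powr (-\<alpha>) < inverse t"
      using powr_threshold \<alpha>_pos t by simp
    from eventually_less_of_limits[OF c[OF \<open>y > 0\<close>] k this] ev
    show "\<forall>\<^sub>F n in sequentially. a (?k n) / a n < y"
    proof eventually_elim
      case (elim n)
      then have "G (a n * y) < G (a (?k n))"
        using p_pos by (simp add: field_simps)
      then have "a (?k n) < a n * y"
        by (rule less_if_G_less)
      then show ?case using elim by (simp add: field_simps)
    qed
  next
    fix y assume y: "y < t powr (1 / \<alpha>)"
    show "\<forall>\<^sub>F n in sequentially. y < a (?k n) / a n"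
    proof (cases "y > 0")
      case False
      show ?thesis using ak a_pos_eventually
        by eventually_elim (use False in \<open>auto intro: order_le_less_trans[of y 0]\<close>)
    next
      case True
      with y have "inverse t < y powr (-\<alpha>)"
        using powr_threshold \<alpha>_pos t by simp
      from eventually_less_of_limits[OF k c[OF True] this] ev
      show ?thesis
      proof eventually_elim
        case (elim n)
        then have "G (a (?k n)) < G (a n * y)"
          using p_pos by (simp add: field_simps)
        then have "a n * y < a (?k n)"
          by (rule less_if_G_less)
        then show ?case using elim by (simp add: field_simps)
      qed
    qed
  qed
qed

context
  assumes a_mono: "\<exists>n0. mono_on {n0..} a"
    and a_rv: "\<And>t. t > 0 \<Longrightarrow> (\<lambda>n. a (nat \<lfloor>real n * t\<rfloor>) / a n) \<longlonglongrightarrow> t powr (1 / \<alpha>)"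
begin

text \<open>A monotone sequence that does not tend to infinity has a finite limit, which is positive; then
\<open>a (2 n) / a n\<close> would tend to \<open>1\<close> instead of \<open>2 powr (1/\<alpha>) > 1\<close>.\<close>

lemma rv_sequence_at_top: "filterlim a at_top sequentially"
proof (rule ccontr)
  assume not_top: "\<not> ?thesis"
  from a_mono obtain n0 where n0: "mono_on {n0..} a" by blast
  have le: "a m \<le> a n" if "n0 \<le> m" "m \<le> n" for m n
    using n0 that by (auto simp: mono_on_def)
  obtain B where B: "\<And>n. n \<ge> n0 \<Longrightarrow> a n \<le> B"
  proof (rule ccontr)
    assume "\<not> thesis"
    then have ex: "\<exists>n\<ge>n0. B < a n" for B
      using that by (meson not_le)
    have "filterlim a at_top sequentially"
      unfolding filterlim_at_top
    proof
      fix Z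
      from ex[of Z] obtain n where n: "n \<ge> n0" "Z < a n" by blast
      show "\<forall>\<^sub>F m in sequentially. Z \<le> a m"
        using eventually_ge_at_top[of n]
      proof eventually_elim
        case (elim m)
        then show ?case using le[of n m] n by simp
      qed
    qed
    with not_top show False by simp
  qed
  define b where "b n = a (n + n0)" for n
  have "incseq b" unfolding b_def by (intro incseq_SucI) (auto intro: le)
  moreover have "\<forall>i. b i \<le> B" unfolding b_def using B by auto
  ultimately obtain L where L: "b \<longlonglongrightarrow> L" "\<forall>i. b i \<le> L"
    by (rule incseq_convergent)
  have "a \<longlonglongrightarrow> L"
    using L(1) unfolding b_def by (rule LIMSEQ_offset)
  moreover have "L > 0"
    using L(2)[rule_format, of 1] a_pos[of "1 + n0"] by (simp add: b_def)
  moreover have "(\<lambda>n. a (nat \<lfloor>real n * 2\<rfloor>)) \<longlonglongrightarrow> L"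
    using calculation(1) floor_mult_at_top[of 2] by (rule filterlim_compose) simp
  ultimately have "(\<lambda>n. a (nat \<lfloor>real n * 2\<rfloor>) / a n) \<longlonglongrightarrow> L / L"
    by (intro tendsto_divide) auto
  then have "L / L = 2 powr (1 / \<alpha>)"
    using a_rv[of 2] by (intro LIMSEQ_unique) auto
  moreover have "2 powr (1 / \<alpha>) > 1"
    using \<alpha>_pos by simp
  ultimately show False using \<open>L > 0\<close> by simp
qed

text \<open>For every \<open>s > 1\<close>, monotonicity gives \<open>a n \<le> a (n + 1) \<le> a \<lfloor>n s\<rfloor>\<close> for large \<open>n\<close>, so the ratio of
neighbours exceeds \<open>1\<close> by at most \<open>s powr (1/\<alpha>) - 1\<close> in the limit.\<close>

lemma rv_sequence_Suc_ratio: "(\<lambda>n. a n / a (Suc n)) \<longlonglongrightarrow> 1"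
proof -
  from a_mono obtain n0 where n0: "mono_on {n0..} a" by blast
  have "(\<lambda>n. a (Suc n) / a n) \<longlonglongrightarrow> 1"
  proof (rule order_tendstoI)
    fix c :: real assume c: "1 < c"
    \<comment> \<open>The number for which \<open>s powr (1/\<alpha>)\<close> lies halfway between \<open>1\<close> and \<open>c\<close>.\<close>
    define s where "s = ((1 + c) / 2) powr \<alpha>"
    have s: "1 < s" "s > 0" "s powr (1 / \<alpha>) = (1 + c) / 2"
      using c \<alpha>_pos by (auto simp: s_def powr_powr)
    have "s powr (1 / \<alpha>) < c" using c s by simp
    from order_tendstoD(2)[OF a_rv[OF s(2)] this]
    have "\<forall>\<^sub>F n in sequentially. a (nat \<lfloor>real n * s\<rfloor>) / a n < c" .
    moreover have "\<forall>\<^sub>F n in sequentially. Suc n \<le> nat \<lfloor>real n * s\<rfloor>"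
      using s(1) by real_asymp
    ultimately show "\<forall>\<^sub>F n in sequentially. a (Suc n) / a n < c"
      using a_pos_eventually eventually_ge_at_top[of n0]
    proof eventually_elim
      case (elim n)
      then have "a (Suc n) \<le> a (nat \<lfloor>real n * s\<rfloor>)"
        using n0 by (auto simp: mono_on_def)
      then show ?case using elim by (simp add: field_simps)
    qed
  next
    fix c :: real assume c: "c < 1"
    show "\<forall>\<^sub>F n in sequentially. c < a (Suc n) / a n"
      using a_pos_eventually eventually_ge_at_top[of n0]
    proof eventually_elim
      case (elim n)
      then have "a n \<le> a (Suc n)"
        using n0 by (auto simp: mono_on_def)
      then have "1 \<le> a (Suc n) / a n" using elim by simp
      then show ?case using c by simp
    qed
  qed
  from tendsto_inverse[OF this] show ?thesis by simp
qed

text \<open>Every large \<open>z\<close> lies between two consecutive terms of the sequence. Since their ratio tends to \<open>1\<close>,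
what is known along the sequence transfers to the continuous parameter.\<close>

lemma bracketing_index:
  obtains \<iota> :: "real \<Rightarrow> nat"
  where "filterlim \<iota> at_top at_top"
    and "\<forall>\<^sub>F z in at_top. a (\<iota> z) \<le> z \<and> z < a (Suc (\<iota> z))"
proof -
  from a_mono obtain n0 where n0: "mono_on {n0..} a" by blast
  have le: "a m \<le> a n" if "n0 \<le> m" "m \<le> n" for m n
    using n0 that by (auto simp: mono_on_def)
  define S where "S z = {n. n0 \<le> n \<and> a n \<le> z}" for z
  define \<iota> where "\<iota> z = Max (S z)" for z
  have fin: "finite (S z)" for z
  proof -
    have "\<forall>\<^sub>F n in sequentially. z < a n"
      using rv_sequence_at_top by (simp add: filterlim_at_top_dense)
    then obtain k where "\<And>n. n \<ge> k \<Longrightarrow> z < a n" by (auto simp: eventually_sequentially)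
    then have "S z \<subseteq> {..<k}" by (force simp: S_def not_le[symmetric])
    then show ?thesis by (rule finite_subset) simp
  qed
  have ge: "k \<le> \<iota> z" if "n0 \<le> k" "a k \<le> z" for k z
    unfolding \<iota>_def using that by (intro Max_ge fin) (simp add: S_def)
  have "filterlim \<iota> at_top at_top"
    unfolding filterlim_at_top
  proof
    fix k
    show "\<forall>\<^sub>F z in at_top. k \<le> \<iota> z"
      using eventually_ge_at_top[of "a (max k n0)"]
      by eventually_elim (use ge[of "max k n0"] in auto)
  qed
  moreover have "\<forall>\<^sub>F z in at_top. a (\<iota> z) \<le> z \<and> z < a (Suc (\<iota> z))"
    using eventually_ge_at_top[of "a n0"]
  proof eventually_elim
    case (elim z)
    then have "S z \<noteq> {}" by (auto simp: S_def)
    then have "\<iota> z \<in> S z" unfolding \<iota>_def by (intro Max_in fin)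
    moreover then have "\<not> a (Suc (\<iota> z)) \<le> z"
      using ge[of "Suc (\<iota> z)" z] by (auto simp: S_def)
    ultimately show ?case by (simp add: S_def)
  qed
  ultimately show ?thesis by (rule that)
qed

context
  fixes \<iota> :: "real \<Rightarrow> nat"
  assumes \<iota>_top: "filterlim \<iota> at_top at_top"
    and \<iota>_bracket: "\<forall>\<^sub>F z in at_top. a (\<iota> z) \<le> z \<and> z < a (Suc (\<iota> z))"
begin

lemma bracket_ratio: "((\<lambda>z. a (\<iota> z) / z) \<longlongrightarrow> 1) at_top"
proof (rule tendsto_sandwich)
  show "((\<lambda>z. a (\<iota> z) / a (Suc (\<iota> z))) \<longlongrightarrow> 1) at_top"
    using rv_sequence_Suc_ratio \<iota>_top by (rule filterlim_compose)
  have pos: "\<forall>\<^sub>F z in at_top. 0 < a (\<iota> z)"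
    using eventually_compose_filterlim[OF a_pos_eventually \<iota>_top] .
  show "\<forall>\<^sub>F z in at_top. a (\<iota> z) / a (Suc (\<iota> z)) \<le> a (\<iota> z) / z"
    using pos \<iota>_bracket by eventually_elim (auto intro!: divide_left_mono mult_pos_pos)
  show "\<forall>\<^sub>F z in at_top. a (\<iota> z) / z \<le> 1"
    using pos \<iota>_bracket by eventually_elim auto
qed auto

lemma G_bracket:
  "\<forall>\<^sub>F z in at_top. p / real (Suc (\<iota> z)) \<le> G z \<and> G z \<le> p / real (\<iota> z)"
proof -
  have 1: "\<forall>\<^sub>F z in at_top. G (a (\<iota> z)) = p / real (\<iota> z)"
    using eventually_compose_filterlim[OF G_quantile \<iota>_top] .
  have 2: "\<forall>\<^sub>F z in at_top. G (a (Suc (\<iota> z))) = p / real (Suc (\<iota> z))"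
    using eventually_compose_filterlim[OF iffD2[OF eventually_sequentially_Suc G_quantile] \<iota>_top] .
  from 1 2 \<iota>_bracket show ?thesis
  proof eventually_elim
    case (elim z)
    have "G (a (Suc (\<iota> z))) \<le> G z" "G z \<le> G (a (\<iota> z))"
      using elim G_le[of z "a (Suc (\<iota> z))"] G_le[of "a (\<iota> z)" z] by auto
    then show ?case using elim by simp
  qed
qed

lemma tail_normalization_ratio: "((\<lambda>z. (p / G z) / real (\<iota> z)) \<longlongrightarrow> 1) at_top"
proof (rule tendsto_sandwich[where f = "\<lambda>_. 1"])
  have "(\<lambda>n. real (Suc n) / real n) \<longlonglongrightarrow> 1" by real_asymp
  then show "((\<lambda>z. real (Suc (\<iota> z)) / real (\<iota> z)) \<longlongrightarrow> 1) at_top"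
    using \<iota>_top by (rule filterlim_compose)
  have pos: "\<forall>\<^sub>F z in at_top. 0 < \<iota> z"
    using eventually_compose_filterlim[OF eventually_gt_at_top \<iota>_top] .
  have G: "0 < G z" for z by (rule G_pos[OF rv_sequence_at_top])
  show "\<forall>\<^sub>F z in at_top. 1 \<le> (p / G z) / real (\<iota> z)"
    using pos G_bracket by eventually_elim (use G in \<open>auto simp: field_simps\<close>)
  show "\<forall>\<^sub>F z in at_top. (p / G z) / real (\<iota> z) \<le> real (Suc (\<iota> z)) / real (\<iota> z)"
    using pos G_bracket by eventually_elim
      (use G in \<open>auto simp: field_simps simp del: of_nat_Suc\<close>)
qed auto

text \<open>If \<open>s powr (1/\<alpha>) < t\<close>, then eventually \<open>a \<lfloor>n s\<rfloor> < t * a n \<le> t z\<close> for the bracketing index \<open>n\<close> of \<open>z\<close>;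
hence \<open>G (t z) \<le> p / \<lfloor>n s\<rfloor>\<close>, while \<open>G z \<ge> p / (n + 1)\<close>. The quotient of these bounds tends to \<open>1 / s\<close>,
which is arbitrarily close to \<open>t powr (-\<alpha>)\<close>. The lower bound is symmetric, with \<open>n\<close> and \<open>n + 1\<close>
exchanged.\<close>

lemma tail_regularly_varying:
  assumes t: "t > 0"
  shows "((\<lambda>z. G (z * t) / G z) \<longlongrightarrow> t powr (-\<alpha>)) at_top"
proof -
  have G: "0 < G z" for z by (rule G_pos[OF rv_sequence_at_top])
  have root: "s powr (1/\<alpha>) < t \<longleftrightarrow> t powr (-\<alpha>) < inverse s"
    "t < s powr (1/\<alpha>) \<longleftrightarrow> inverse s < t powr (-\<alpha>)" if "s > 0" for s
    using powr_threshold[OF \<alpha>_pos t that] by auto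
  show ?thesis
  proof (rule order_tendstoI)
    fix y assume y: "t powr (-\<alpha>) < y"
    then obtain x where x: "t powr (-\<alpha>) < x" "x < y" using dense by blast
    have "x > 0" using t by (intro less_trans[OF _ x(1)]) simp
    define s where "s = inverse x"
    have s: "s > 0" "inverse s = x" using \<open>x > 0\<close> by (auto simp: s_def)
    have "\<forall>\<^sub>F n in sequentially. a (nat \<lfloor>real n * s\<rfloor>) / a n < t"
      using order_tendstoD(2)[OF a_rv[OF s(1)]] root(1)[OF s(1)] s x by simp
    moreover have "(\<lambda>n. real (Suc n) / real (nat \<lfloor>real n * s\<rfloor>)) \<longlonglongrightarrow> inverse s"
      using s(1) by real_asymp
    then have "\<forall>\<^sub>F n in sequentially. real (Suc n) / real (nat \<lfloor>real n * s\<rfloor>) < y"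
      using order_tendstoD(2) s x by blast
    moreover have "\<forall>\<^sub>F n in sequentially. G (a (nat \<lfloor>real n * s\<rfloor>)) = p / real (nat \<lfloor>real n * s\<rfloor>)"
      using eventually_compose_filterlim[OF G_quantile floor_mult_at_top[OF s(1)]] .
    moreover have "\<forall>\<^sub>F n in sequentially. nat \<lfloor>real n * s\<rfloor> > 0"
      using eventually_compose_filterlim[OF eventually_gt_at_top[of 0] floor_mult_at_top[OF s(1)]] .
    ultimately have "\<forall>\<^sub>F n in sequentially. a (nat \<lfloor>real n * s\<rfloor>) < t * a n \<and>
        G (a (nat \<lfloor>real n * s\<rfloor>)) < y * (p / real (Suc n))"
      using a_pos_eventually
    proof eventually_elim
      case (elim n)
      then have "p * (real (Suc n) / real (nat \<lfloor>real n * s\<rfloor>)) < p * y"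
        using p_pos by (intro mult_strict_left_mono)
      then show ?case using elim by (simp add: field_simps)
    qed
    from eventually_compose_filterlim[OF this \<iota>_top] \<iota>_bracket G_bracket
    show "\<forall>\<^sub>F z in at_top. G (z * t) / G z < y"
    proof eventually_elim
      case (elim z)
      let ?k = "nat \<lfloor>real (\<iota> z) * s\<rfloor>"
      have "t * a (\<iota> z) \<le> z * t" using elim t by simp
      then have "G (z * t) \<le> G (a ?k)" using elim by (intro G_le) linarith
      also have "\<dots> < y * (p / real (Suc (\<iota> z)))" using elim by simp
      also have "\<dots> \<le> y * G z"
        using elim x \<open>x > 0\<close> by (intro mult_left_mono) auto
      finally show ?case using G[of z] by (simp add: field_simps)
    qed
  next
    fix y assume y: "y < t powr (-\<alpha>)"
    show "\<forall>\<^sub>F z in at_top. y < G (z * t) / G z"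
    proof (cases "y > 0")
      case False
      then show ?thesis
        by (intro always_eventually allI order_le_less_trans[of y 0] divide_pos_pos G) simp
    next
      case True
      from y obtain x where x: "x < t powr (-\<alpha>)" "y < x" using dense by blast
      then have "x > 0" using True by simp
      define s where "s = inverse x"
      have s: "s > 0" "inverse s = x" using \<open>x > 0\<close> by (auto simp: s_def)
      have "\<forall>\<^sub>F n in sequentially. t < a (nat \<lfloor>real n * s\<rfloor>) / a n"
        using order_tendstoD(1)[OF a_rv[OF s(1)]] root(2)[OF s(1)] s x by simp
      \<comment> \<open>Stated at \<open>n\<close>, but needed at \<open>n + 1\<close>, the upper bracketing index; hence the shift by one.\<close>
      moreover have "(\<lambda>n. real (n - 1) / real (nat \<lfloor>real n * s\<rfloor>)) \<longlonglongrightarrow> inverse s"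
        using s(1) by real_asymp
      then have "\<forall>\<^sub>F n in sequentially. y < real (n - 1) / real (nat \<lfloor>real n * s\<rfloor>)"
        using order_tendstoD(1) s x by blast
      moreover have "\<forall>\<^sub>F n in sequentially. G (a (nat \<lfloor>real n * s\<rfloor>)) = p / real (nat \<lfloor>real n * s\<rfloor>)"
        using eventually_compose_filterlim[OF G_quantile floor_mult_at_top[OF s(1)]] .
      moreover have "\<forall>\<^sub>F n in sequentially. nat \<lfloor>real n * s\<rfloor> > 0"
        using eventually_compose_filterlim[OF eventually_gt_at_top[of 0] floor_mult_at_top[OF s(1)]] .
      ultimately have "\<forall>\<^sub>F n in sequentially. t * a n < a (nat \<lfloor>real n * s\<rfloor>) \<and>
          y * (p / real (n - 1)) < G (a (nat \<lfloor>real n * s\<rfloor>))"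
        using a_pos_eventually eventually_gt_at_top[of 1]
      proof eventually_elim
        case (elim n)
        then have "real (n - 1) > 0" by simp
        moreover have "p * y < p * (real (n - 1) / real (nat \<lfloor>real n * s\<rfloor>))"
          using p_pos elim by (intro mult_strict_left_mono)
        ultimately show ?case using elim by (simp add: field_simps)
      qed
      then have "\<forall>\<^sub>F n in sequentially. t * a (Suc n) < a (nat \<lfloor>real (Suc n) * s\<rfloor>) \<and>
          y * (p / real n) < G (a (nat \<lfloor>real (Suc n) * s\<rfloor>))"
        by (subst (asm) eventually_sequentially_Suc[symmetric]) simp
      from eventually_compose_filterlim[OF this \<iota>_top] \<iota>_bracket G_bracket
      show ?thesis
      proof eventually_elim
        case (elim z)
        let ?k = "nat \<lfloor>real (Suc (\<iota> z)) * s\<rfloor>"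
        have "y * G z \<le> y * (p / real (\<iota> z))"
          using elim True by (intro mult_left_mono) auto
        also have "\<dots> < G (a ?k)" using elim by simp
        also have "z * t \<le> t * a (Suc (\<iota> z))" using elim t by simp
        then have "G (a ?k) \<le> G (z * t)" using elim by (intro G_le) linarith
        finally show ?case using G[of z] by (simp add: field_simps)
      qed
    qed
  qed
qed

end
end
end

section \<open>Equivalence of the two notions of regular variation\<close>

theorem lemma5p2:
  fixes N :: "real^'d::finite \<Rightarrow> real"
    and Q :: "(real^'l::finite) set"
    and M :: "'w measure"
    and X :: "'w \<Rightarrow> real^'l \<Rightarrow> real^'d"
    and \<alpha> :: real
    and \<nu> :: "(real^'l \<Rightarrow> real^'d) measure"
    and t0 :: "real^'l"
    and a :: "nat \<Rightarrow> real"
  assumes "is_norm N"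
    and "countable Q" and "closure Q = UNIV"
    and "prob_space M" and "complete_measure M"
    and "X \<in> measurable M D_borel"
    and "\<not> (AE w in M. X w = (\<lambda>_. 0))"
    and "\<alpha> > 0"
    and "\<nu> \<in> M_plus N"
    and "tail_measure N Q \<alpha> (extend_D \<nu>)"
    and "tail_const N \<nu> t0 > 0"
    and "\<forall>n\<ge>1. a n > 0"
    and "\<forall>\<^sub>F n in sequentially. real n * tail_prob N M X t0 (a n) = tail_const N \<nu> t0"
  shows "reg_var N t0 M X \<alpha> \<nu> \<longleftrightarrow> reg_var_seq N M X \<alpha> a \<nu>"
proof -
  define G where "G = tail_prob N M X t0"
  define p where "p = tail_const N \<nu> t0"
  interpret M: prob_space M by (rule assms)
  have measurable: "{w \<in> space M. N (X w t0) > z} \<in> sets M" for z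
  proof -
    have "X -` {f \<in> D_space. N (f t0) > z} \<inter> space M \<in> sets M"
      by (intro measurable_sets[OF assms(6)] D_borel_exceedance is_norm_continuous assms)
    also have "X -` {f \<in> D_space. N (f t0) > z} \<inter> space M = {w \<in> space M. N (X w t0) > z}"
      using measurable_space[OF assms(6)] by (auto simp: space_borel_sigma topspace_D_top)
    finally show ?thesis .
  qed
  interpret tail_quantile G a p \<alpha>
  proof
    show "antimono G"
      by (auto simp: antimono_def G_def tail_prob_def intro!: M.finite_measure_mono measurable monoI)
    show "0 \<le> G z" for z by (simp add: G_def tail_prob_def)
  qed (use assms in \<open>auto simp: G_def p_def\<close>)
  show ?thesis
  proof
    assume rv: "reg_var N t0 M X \<alpha> \<nu>"
    then have ratio: "((\<lambda>z. G (z * t) / G z) \<longlongrightarrow> t powr (-\<alpha>)) at_top" if "t > 0" for t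
      using that by (simp add: reg_var_def G_def)
    \<comment> \<open>A tail that vanishes from some point on has ratio \<open>0 / 0 = 0\<close> there, whose limit is not \<open>1\<close>.\<close>
    have G: "0 < G z" for z
    proof (rule ccontr)
      assume "\<not> 0 < G z"
      have "\<forall>\<^sub>F y in at_top. G (y * 1) / G y = 0"
        using eventually_ge_at_top[of z]
      proof eventually_elim
        case (elim y)
        have "G y = 0" using G_le[OF elim] G_nonneg[of y] \<open>\<not> 0 < G z\<close> by linarith
        then show ?case by simp
      qed
      then have "((\<lambda>y. G (y * 1) / G y) \<longlongrightarrow> 0) at_top" by (rule tendsto_eventually)
      with ratio[of 1] have "1 powr (-\<alpha>) = 0"
        by (intro tendsto_unique[OF trivial_limit_at_top_linorder]) auto
      then show False by simp
    qed
    note top = quantile_at_top[OF G]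
    \<comment> \<open>The limit at infinity is restricted to \<open>z = a n\<close>, where \<open>p / G z\<close> is \<open>n\<close>.\<close>
    have "vague_limit N (\<lambda>n. scaled_law M X (p / G (a n)) (a n)) \<nu> sequentially"
      using vague_limit_compose[OF conjunct2[OF rv[unfolded reg_var_def]] top] by (simp add: G_def p_def)
    moreover have "\<forall>\<^sub>F n in sequentially. scaled_law M X (p / G (a n)) (a n) = scaled_law M X (real n) (a n)"
      using G_quantile eventually_gt_at_top[of 0] by eventually_elim (use p_pos in simp)
    ultimately have "vague_limit N (\<lambda>n. scaled_law M X (real n) (a n)) \<nu> sequentially"
      by (simp add: vague_limit_cong)
    then show "reg_var_seq N M X \<alpha> a \<nu>"
      unfolding reg_var_seq_def
      using assms(12) quantile_eventually_mono quantile_regularly_varying[OF ratio top] by blast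
  next
    assume rvs: "reg_var_seq N M X \<alpha> a \<nu>"
    then have mono: "\<exists>n0. mono_on {n0..} a"
      and seq: "\<And>t. t > 0 \<Longrightarrow> (\<lambda>n. a (nat \<lfloor>real n * t\<rfloor>) / a n) \<longlonglongrightarrow> t powr (1 / \<alpha>)"
      and lim: "vague_limit N (\<lambda>n. scaled_law M X (real n) (a n)) \<nu> sequentially"
      by (auto simp: reg_var_seq_def)
    obtain \<iota> where \<iota>: "filterlim \<iota> at_top at_top"
      "\<forall>\<^sub>F z in at_top. a (\<iota> z) \<le> z \<and> z < a (Suc (\<iota> z))"
      using bracketing_index[OF mono seq] .
    note limits = bracket_ratio[OF mono seq \<iota>] tail_normalization_ratio[OF mono seq \<iota>]
      tail_regularly_varying[OF mono seq \<iota>]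
    have "\<forall>\<^sub>F z in at_top. 0 < a (\<iota> z)" "\<forall>\<^sub>F z in at_top. 0 < \<iota> z"
      using eventually_compose_filterlim[OF a_pos_eventually \<iota>(1)]
        eventually_compose_filterlim[OF eventually_gt_at_top \<iota>(1)] by auto
    \<comment> \<open>From the sequence to the bracketing terms, then from \<open>a (\<iota> z)\<close> to \<open>z\<close>, then from \<open>\<iota> z\<close> to \<open>p / G z\<close>.\<close>
    then have "vague_limit N (\<lambda>z. scaled_law M X (real (\<iota> z)) z) \<nu> at_top"
      by (intro vague_limit_rescale[OF assms(4,6,1,9) vague_limit_compose[OF lim \<iota>(1)] _ _ _ limits(1)])
        (auto intro: eventually_gt_at_top)
    then have "vague_limit N (\<lambda>z. scaled_law M X (p / G z) z) \<nu> at_top"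
      by (rule vague_limit_change_mass[OF assms(4,6) _ _ _ limits(2)])
        (use \<open>\<forall>\<^sub>F z in at_top. 0 < \<iota> z\<close> p_pos G_nonneg in \<open>auto simp: less_imp_le\<close>)
    with limits(3) show "reg_var N t0 M X \<alpha> \<nu>"
      by (simp add: reg_var_def G_def p_def)
  qed
qed

end
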